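(* Let $n < 8$. Let $\phi$ and $\psi$ be constant-free, negation-free linear formulae on the same set of $n$ variables, and suppose $\phi \to \psi$ is a non-trivial linear inference. Then $\phi$ is $\{\mathsf{s},\mathsf{m}\}$-derivable to $\psi$ without units, i.e. $\phi \overset{*}{\rightsquigarrow}_{\{\mathsf{s},\mathsf{m}\}} \psi$.
   Context: Fix a countably infinite set of variables. Linear formulae on a finite set $\mathcal{V}$ of variables are defined inductively: - $\top$ and $\bot$ are linear formulae on $\emptyset$. - $x$ and $\neg x$ are linear formulae on $\{x\}$. - If $\phi$ is on $\mathcal{V}_1$, $\psi$ is on $\mathcal{V}_2$ and $\mathcal{V}_1\cap\mathcal{V}_2=\emptyset$, then $\phi\lor\psi$ and $\phi\land\psi$ are on $\mathcal{V}_1\cup\mathcal{V}_2$. A formula is constant-free if it contains no $\top,\bot$, and negation-free if it contains no $\neg x$. Formulae are evaluated under Boolean assignments as usual. A linear inference $\phi\to\psi$ is a pair of linear formulae such that every assignment satisfying $\phi$ satisfies $\psi$. An inference $\phi\to\psi$ is trivial at a variable $x$ if $\phi[\top/x]\to\psi[\bot/x]$ is again a valid inference. It is trivial if it is trivial at one of its variables, and non-trivial otherwise. $\sim_{\mathsf{ac}}$ is the smallest equivalence relation on formulae, closed under $\land$- and $\lor$-contexts, containing commutativity and associativity of $\land$ and $\lor$. For a set $S$ of linear inferences, $\to_S$ is the smallest relation containing $S$ and closed under substitution (of linear formulae for variables, keeping linearity) and contexts. We write $\phi\rightsquigarrow_S\psi$ if $\phi\sim_{\mathsf{ac}}\phi'\to_S\psi'\sim_{\mathsf{ac}}\psi$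 for some $\phi',\psi'$, and $\overset{*}{\rightsquigarrow}_S$ for the reflexive-transitive closure of $\rightsquigarrow_S\cup\sim_{\mathsf{ac}}$ ($S$-derivability without units). Switch $\mathsf{s}$ is $x\land(y\lor z)\to(x\land y)\lor z$; medial $\mathsf{m}$ is $(w\land x)\lor(y\land z)\to(w\lor y)\land(x\lor z)$. *)

theory Defs
  imports Main
begin

datatype form = Top | Bot | Var nat | NVar nat | And form form | Or form form

fun vars :: "form \<Rightarrow> nat set" where
  "vars Top = {}" | "vars Bot = {}" | "vars (Var x) = {x}" | "vars (NVar x) = {x}"
| "vars (And a b) = vars a \<union> vars b" | "vars (Or a b) = vars a \<union> vars b"

fun linear :: "form \<Rightarrow> bool" where
  "linear (And a b) = (linear a \<and> linear b \<and> vars a \<inter> vars b = {})"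
| "linear (Or a b) = (linear a \<and> linear b \<and> vars a \<inter> vars b = {})"
| "linear _ = True"

fun constant_free :: "form \<Rightarrow> bool" where
  "constant_free Top = False" | "constant_free Bot = False"
| "constant_free (And a b) = (constant_free a \<and> constant_free b)"
| "constant_free (Or a b) = (constant_free a \<and> constant_free b)"
| "constant_free _ = True"

fun negation_free :: "form \<Rightarrow> bool" where
  "negation_free (NVar _) = False"
| "negation_free (And a b) = (negation_free a \<and> negation_free b)"
| "negation_free (Or a b) = (negation_free a \<and> negation_free b)"
| "negation_free _ = True"

fun eval :: "(nat \<Rightarrow> bool) \<Rightarrow> form \<Rightarrow> bool" where
  "eval v Top = True" | "eval v Bot = False" | "eval v (Var x) = v x"
| "eval v (NVar x) = (\<not> v x)"
| "eval v (And a b) = (eval v a \<and> eval v b)"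
| "eval v (Or a b) = (eval v a \<or> eval v b)"

fun neg :: "form \<Rightarrow> form" where
  "neg Top = Bot" | "neg Bot = Top" | "neg (Var x) = NVar x" | "neg (NVar x) = Var x"
| "neg (And a b) = Or (neg a) (neg b)" | "neg (Or a b) = And (neg a) (neg b)"

fun subst :: "(nat \<Rightarrow> form) \<Rightarrow> form \<Rightarrow> form" where
  "subst \<sigma> Top = Top" | "subst \<sigma> Bot = Bot" | "subst \<sigma> (Var x) = \<sigma> x"
| "subst \<sigma> (NVar x) = neg (\<sigma> x)"
| "subst \<sigma> (And a b) = And (subst \<sigma> a) (subst \<sigma> b)"
| "subst \<sigma> (Or a b) = Or (subst \<sigma> a) (subst \<sigma> b)"

definition valid_inf :: "form \<Rightarrow> form \<Rightarrow> bool" where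
  "valid_inf \<phi> \<psi> \<longleftrightarrow> (\<forall>v. eval v \<phi> \<longrightarrow> eval v \<psi>)"

definition linear_inference :: "form \<Rightarrow> form \<Rightarrow> bool" where
  "linear_inference \<phi> \<psi> \<longleftrightarrow> linear \<phi> \<and> linear \<psi> \<and> valid_inf \<phi> \<psi>"

definition trivial_at :: "form \<Rightarrow> form \<Rightarrow> nat \<Rightarrow> bool" where
  "trivial_at \<phi> \<psi> x \<longleftrightarrow>
     valid_inf (subst (Var(x := Top)) \<phi>) (subst (Var(x := Bot)) \<psi>)"

definition trivial :: "form \<Rightarrow> form \<Rightarrow> bool" where
  "trivial \<phi> \<psi> \<longleftrightarrow> (\<exists>x \<in> vars \<phi> \<union> vars \<psi>. trivial_at \<phi> \<psi> x)"

inductive ac :: "form \<Rightarrow> form \<Rightarrow> bool" where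
  ac_refl: "ac a a"
| ac_sym: "ac a b \<Longrightarrow> ac b a"
| ac_trans: "ac a b \<Longrightarrow> ac b c \<Longrightarrow> ac a c"
| ac_and: "ac a a' \<Longrightarrow> ac b b' \<Longrightarrow> ac (And a b) (And a' b')"
| ac_or: "ac a a' \<Longrightarrow> ac b b' \<Longrightarrow> ac (Or a b) (Or a' b')"
| ac_and_comm: "ac (And a b) (And b a)"
| ac_or_comm: "ac (Or a b) (Or b a)"
| ac_and_assoc: "ac (And (And a b) c) (And a (And b c))"
| ac_or_assoc: "ac (Or (Or a b) c) (Or a (Or b c))"

inductive red :: "(form \<times> form) set \<Rightarrow> form \<Rightarrow> form \<Rightarrow> bool" for S where
  red_rule: "(l, r) \<in> S \<Longrightarrow> red S l r"
| red_subst: "red S a b \<Longrightarrow> linear (subst \<sigma> a) \<Longrightarrow> linear (subst \<sigma> b)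
              \<Longrightarrow> red S (subst \<sigma> a) (subst \<sigma> b)"
| red_and_l: "red S a b \<Longrightarrow> linear (And a c) \<Longrightarrow> linear (And b c) \<Longrightarrow> red S (And a c) (And b c)"
| red_and_r: "red S a b \<Longrightarrow> linear (And c a) \<Longrightarrow> linear (And c b) \<Longrightarrow> red S (And c a) (And c b)"
| red_or_l: "red S a b \<Longrightarrow> linear (Or a c) \<Longrightarrow> linear (Or b c) \<Longrightarrow> red S (Or a c) (Or b c)"
| red_or_r: "red S a b \<Longrightarrow> linear (Or c a) \<Longrightarrow> linear (Or c b) \<Longrightarrow> red S (Or c a) (Or c b)"

definition rsq :: "(form \<times> form) set \<Rightarrow> form \<Rightarrow> form \<Rightarrow> bool" where
  "rsq S a b \<longleftrightarrow> (\<exists>a' b'. ac a a' \<and> red S a' b' \<and> ac b' b)"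

definition derivable :: "(form \<times> form) set \<Rightarrow> form \<Rightarrow> form \<Rightarrow> bool" where
  "derivable S = (\<lambda>a b. rsq S a b \<or> ac a b)\<^sup>*\<^sup>*"

definition switch :: "form \<times> form" where
  "switch = (And (Var 0) (Or (Var 1) (Var 2)), Or (And (Var 0) (Var 1)) (Var 2))"

definition medial :: "form \<times> form" where
  "medial = (Or (And (Var 0) (Var 1)) (And (Var 2) (Var 3)),
             And (Or (Var 0) (Var 2)) (Or (Var 1) (Var 3)))"

end

theory Submission
  imports Defs
begin

text \<open>
  Induction on the number of variables. If \<open>\<psi> = p \<and> q\<close>, non-triviality forces every disjunction
  in \<open>\<phi>\<close> to be either monochromatic or to have only bichromatic disjuncts with respect to
  \<open>vars p\<close> and \<open>vars q\<close>, so \<open>\<phi>\<close> reduces by medial to \<open>g \<and> h\<close> with \<open>g \<rightarrow> p\<close> and \<open>h \<rightarrow> q\<close> again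
  non-trivial; the case \<open>\<phi> = p \<or> q\<close> is dual. There remain inferences from a conjunction to a
  disjunction. If \<open>\<phi> = x \<and> r\<close>, then \<open>x\<close> occurs in \<open>\<psi>\<close> as a conjunct \<open>x \<and> c\<close> of some subformula,
  and \<open>x\<close> can be pulled out of \<open>\<psi>\<close> by switches. If no conjunct of \<open>\<phi>\<close> and no disjunct of \<open>\<psi>\<close> is
  a variable, then a counting argument (where the bound 7 enters) yields a conjunct \<open>c \<or> d\<close> of \<open>\<phi>\<close>
  with \<open>c \<rightarrow> \<psi>\<close> valid, or dually; a single switch then replaces \<open>\<phi> = (c \<or> d) \<and> r\<close> by the
  disjunction \<open>(r \<and> d) \<or> c\<close>, which still implies \<open>\<psi>\<close>.
\<close>

text \<open>The number of variables drops only where a formula splits: \<open>g\<close> and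
  \<open>h\<close> live on the disjoint nonempty sets \<open>vars p\<close> and
  \<open>vars q\<close>, and pulling out \<open>x\<close> leaves \<open>r\<close> with one variable
  less. The final switch does not lower it, but its result is a disjunction, so the dual of the
  medial case applies at once. The obstacle is that each intermediate formula must still imply the
  conclusion. Non-triviality is never at risk, since weakening the premise or strengthening the
  conclusion keeps every witnessing assignment; so for the switch only the validity of
  \<open>c \<rightarrow> \<psi>\<close> matters. The counting starts from the failure of such
  implications on both sides. Each disjunct of a conjunct of \<open>\<phi>\<close> then has a true
  set that does not satisfy \<open>\<psi>\<close>, each conjunct of a disjunct of
  \<open>\<psi>\<close> a false set that does not refute \<open>\<phi>\<close>. True sets and false
  sets of a monotone formula intersect, so the failures force variables into existence; with two
  conjuncts of two disjuncts, four disjoint true sets without a singleton already need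
  eight.\<close>

fun dual :: "form \<Rightarrow> form" where
  "dual Top = Bot" | "dual Bot = Top" | "dual (Var x) = Var x" | "dual (NVar x) = NVar x"
| "dual (And a b) = Or (dual a) (dual b)" | "dual (Or a b) = And (dual a) (dual b)"

text \<open>Merges the three syntactic hypotheses, so that inductions over formulae keep only three
  cases and evaluation is monotone.\<close>

fun positive :: "form \<Rightarrow> bool" where
  "positive (Var x) = True"
| "positive (And a b) = (positive a \<and> positive b \<and> vars a \<inter> vars b = {})"
| "positive (Or a b) = (positive a \<and> positive b \<and> vars a \<inter> vars b = {})"
| "positive _ = False"

lemma positive_iff: "positive f \<longleftrightarrow> linear f \<and> constant_free f \<and> negation_free f"
  by (induction f) auto

lemma finite_vars [simp]: "finite (vars f)"
  by (induction f) auto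

lemma vars_nonempty: "positive f \<Longrightarrow> vars f \<noteq> {}"
  by (induction f) auto

lemma card_vars_pos: "positive f \<Longrightarrow> 0 < card (vars f)"
  by (simp add: card_gt_0_iff vars_nonempty)

lemma vars_dual [simp]: "vars (dual f) = vars f"
  by (induction f) auto

lemma dual_dual [simp]: "dual (dual f) = f"
  by (induction f) auto

lemma positive_dual [simp]: "positive (dual f) = positive f"
  by (induction f) auto

text \<open>Unlike \<open>neg\<close>, \<open>dual\<close> keeps the variables, so positivity
  survives and the negation moves into the assignment. This is what makes an argument about
  conjunctive conclusions serve disjunctive premises as well.\<close>

lemma eval_dual: "positive f \<Longrightarrow> eval v (dual f) \<longleftrightarrow> \<not> eval (\<lambda>x. \<not> v x) f"
  by (induction f) auto

lemma eval_mono: "positive f \<Longrightarrow> eval v f \<Longrightarrow> (\<And>x. x \<in> vars f \<Longrightarrow> v x \<Longrightarrow> w x) \<Longrightarrow> eval w f"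
  by (induction f) auto

lemma eval_cong_vars: "(\<And>x. x \<in> vars f \<Longrightarrow> v x = w x) \<Longrightarrow> eval v f = eval w f"
  by (induction f) auto

lemma eval_all_true: "positive f \<Longrightarrow> (\<And>x. x \<in> vars f \<Longrightarrow> v x) \<Longrightarrow> eval v f"
  by (induction f) auto

lemma eval_all_false: "positive f \<Longrightarrow> (\<And>x. x \<in> vars f \<Longrightarrow> \<not> v x) \<Longrightarrow> \<not> eval v f"
  by (induction f) auto

subsection \<open>Derivations\<close>

text \<open>Rule instances without the linearity conditions of \<open>red\<close>, so that closure
  under contexts and duality has no side conditions. Steps preserve variables and linearity, hence
  \<open>step_red\<close> recovers those conditions from a linear source.\<close>

inductive step :: "form \<Rightarrow> form \<Rightarrow> bool" where
  step_switch: "step (And a (Or b c)) (Or (And a b) c)"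
| step_medial: "step (Or (And a b) (And c d)) (And (Or a c) (Or b d))"
| step_and_l: "step a b \<Longrightarrow> step (And a c) (And b c)"
| step_and_r: "step a b \<Longrightarrow> step (And c a) (And c b)"
| step_or_l: "step a b \<Longrightarrow> step (Or a c) (Or b c)"
| step_or_r: "step a b \<Longrightarrow> step (Or c a) (Or c b)"

abbreviation der :: "form \<Rightarrow> form \<Rightarrow> bool" where
  "der \<equiv> (\<lambda>a b. step a b \<or> ac a b)\<^sup>*\<^sup>*"

lemma ac_vars: "ac a b \<Longrightarrow> vars a = vars b"
  by (induction rule: ac.induct) auto

lemma ac_eval: "ac a b \<Longrightarrow> eval v a = eval v b"
  by (induction rule: ac.induct) auto

lemma ac_linear: "ac a b \<Longrightarrow> linear a = linear b"
  by (induction rule: ac.induct) (auto dest!: ac_vars)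

lemma ac_positive: "ac a b \<Longrightarrow> positive a = positive b"
  by (induction rule: ac.induct) (auto dest!: ac_vars)

lemma ac_dual: "ac a b \<Longrightarrow> ac (dual a) (dual b)"
  by (induction rule: ac.induct) (auto intro: ac.intros)

lemma step_vars: "step a b \<Longrightarrow> vars a = vars b"
  by (induction rule: step.induct) auto

lemma step_eval: "step a b \<Longrightarrow> eval v a \<Longrightarrow> eval v b"
  by (induction rule: step.induct) auto

lemma step_linear: "step a b \<Longrightarrow> linear a \<Longrightarrow> linear b"
  by (induction rule: step.induct) (auto dest: step_vars)

lemma step_positive: "step a b \<Longrightarrow> positive a \<Longrightarrow> positive b"
  by (induction rule: step.induct) (auto dest: step_vars)

lemma red_switch:
  assumes "linear (And a (Or b c))"
  shows "red {switch, medial} (And a (Or b c)) (Or (And a b) c)"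
proof -
  let ?s = "\<lambda>n::nat. if n = 0 then a else if n = 1 then b else c"
  have "red {switch, medial} (fst switch) (snd switch)"
    by (rule red_rule) simp
  then have "red {switch, medial} (subst ?s (fst switch)) (subst ?s (snd switch))"
    using assms by (intro red_subst) (auto simp: switch_def)
  then show ?thesis by (simp add: switch_def)
qed

lemma red_medial:
  assumes "linear (Or (And a b) (And c d))"
  shows "red {switch, medial} (Or (And a b) (And c d)) (And (Or a c) (Or b d))"
proof -
  let ?s = "\<lambda>n::nat. if n = 0 then a else if n = 1 then b else if n = 2 then c else d"
  have "red {switch, medial} (fst medial) (snd medial)"
    by (rule red_rule) simp
  then have "red {switch, medial} (subst ?s (fst medial)) (subst ?s (snd medial))"
    using assms by (intro red_subst) (auto simp: medial_def)
  then show ?thesis by (simp add: medial_def)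
qed

lemma step_red: "step a b \<Longrightarrow> linear a \<Longrightarrow> red {switch, medial} a b"
proof (induction rule: step.induct)
  case (step_and_l a b c)
  with step.step_and_l[of a b c] step_linear step_vars[of a b] show ?case by (intro red_and_l) auto
next
  case (step_and_r a b c)
  with step.step_and_r[of a b c] step_linear step_vars[of a b] show ?case by (intro red_and_r) auto
next
  case (step_or_l a b c)
  with step.step_or_l[of a b c] step_linear step_vars[of a b] show ?case by (intro red_or_l) auto
next
  case (step_or_r a b c)
  with step.step_or_r[of a b c] step_linear step_vars[of a b] show ?case by (intro red_or_r) auto
qed (use red_switch red_medial in auto)

lemma der_derivable:
  assumes "der a b" "linear a"
  shows "derivable {switch, medial} a b \<and> linear b"
  using assms(1)
proof (induction rule: rtranclp_induct)
  case base
  then show ?case using assms(2) by (simp add: derivable_def)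
next
  case (step b c)
  have "rsq {switch, medial} b c \<or> ac b c"
    using step step_red ac_refl unfolding rsq_def by blast
  then show ?case
    using step step_linear ac_linear unfolding derivable_def
    by (metis (mono_tags, lifting) rtranclp.rtrancl_into_rtrancl)
qed

lemma der_ac: "ac a b \<Longrightarrow> der a b"
  by auto

lemma der_step: "step a b \<Longrightarrow> der a b"
  by auto

lemma der_trans [trans]: "der a b \<Longrightarrow> der b c \<Longrightarrow> der a c"
  by (rule rtranclp_trans)

lemma der_and: assumes "der a a'" "der b b'" shows "der (And a b) (And a' b')"
proof -
  have "der (And a b) (And a' b)" using assms(1)
    by (induction rule: rtranclp_induct)
       (auto intro: rtranclp.rtrancl_into_rtrancl step_and_l ac_and ac_refl)
  also have "der (And a' b) (And a' b')" using assms(2)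
    by (induction rule: rtranclp_induct)
       (auto intro: rtranclp.rtrancl_into_rtrancl step_and_r ac_and ac_refl)
  finally show ?thesis .
qed

lemma der_or: assumes "der a a'" "der b b'" shows "der (Or a b) (Or a' b')"
proof -
  have "der (Or a b) (Or a' b)" using assms(1)
    by (induction rule: rtranclp_induct)
       (auto intro: rtranclp.rtrancl_into_rtrancl step_or_l ac_or ac_refl)
  also have "der (Or a' b) (Or a' b')" using assms(2)
    by (induction rule: rtranclp_induct)
       (auto intro: rtranclp.rtrancl_into_rtrancl step_or_r ac_or ac_refl)
  finally show ?thesis .
qed

lemma der_vars: "der a b \<Longrightarrow> vars a = vars b"
  by (induction rule: rtranclp_induct) (auto dest: step_vars ac_vars)

lemma der_eval: "der a b \<Longrightarrow> eval v a \<Longrightarrow> eval v b"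
  by (induction rule: rtranclp_induct) (auto dest: step_eval ac_eval)

lemma der_positive: "der a b \<Longrightarrow> positive a \<Longrightarrow> positive b"
  by (induction rule: rtranclp_induct) (auto dest: step_positive ac_positive)

text \<open>Switch is self-dual up to ac with \<open>a\<close> and \<open>c\<close> exchanged; the
  dual of a medial instance is the medial instance with \<open>b\<close> and \<open>c\<close>
  exchanged.\<close>

lemma step_dual: "step a b \<Longrightarrow> der (dual b) (dual a)"
proof (induction rule: step.induct)
  case (step_switch a b c)
  let ?a = "dual a" and ?b = "dual b" and ?c = "dual c"
  have "ac (And (Or ?a ?b) ?c) (And ?c (Or ?b ?a))"
    by (rule ac_trans[OF ac_and[OF ac_or_comm ac_refl] ac_and_comm])
  moreover have "step (And ?c (Or ?b ?a)) (Or (And ?c ?b) ?a)" by (rule step.step_switch)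
  moreover have "ac (Or (And ?c ?b) ?a) (Or ?a (And ?b ?c))"
    by (rule ac_trans[OF ac_or[OF ac_and_comm ac_refl] ac_or_comm])
  ultimately show ?case by (simp add: der_trans[OF der_ac der_trans[OF der_step der_ac]])
next
  case (step_medial a b c d)
  then show ?case by (simp add: der_step step.step_medial)
qed (auto intro!: der_and der_or)

lemma der_dual: "der a b \<Longrightarrow> der (dual b) (dual a)"
proof (induction rule: rtranclp_induct)
  case (step b c)
  then have "der (dual c) (dual b)" using step_dual ac_dual ac_sym der_ac by blast
  then show ?case using step.IH by (rule der_trans)
qed simp

lemma der_dual_iff: "der (dual b) (dual a) \<longleftrightarrow> der a b"
  using der_dual[of a b] der_dual[of "dual b" "dual a"] by auto

subsection \<open>Non-trivial inferences\<close>

text \<open>The constants substituted by \<open>trivial_at\<close> become updates of the assignment,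
  so that all formulae stay positive.\<close>

definition nontrivial_inf :: "form \<Rightarrow> form \<Rightarrow> bool" where
  "nontrivial_inf f g \<longleftrightarrow> positive f \<and> positive g \<and> vars f = vars g \<and> valid_inf f g \<and>
     (\<forall>x \<in> vars f. \<exists>v. eval (v(x := True)) f \<and> \<not> eval (v(x := False)) g)"

lemma eval_subst_top: "positive f \<Longrightarrow> eval v (subst (Var(x := Top)) f) = eval (v(x := True)) f"
  by (induction f) auto

lemma eval_subst_bot: "positive f \<Longrightarrow> eval v (subst (Var(x := Bot)) f) = eval (v(x := False)) f"
  by (induction f) auto

lemma nontrivial_infI:
  assumes "positive f" "positive g" "vars f = vars g" "valid_inf f g" "\<not> trivial f g"
  shows "nontrivial_inf f g"
  using assms unfolding nontrivial_inf_def trivial_def trivial_at_def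
  by (auto simp: valid_inf_def eval_subst_top eval_subst_bot)

lemma valid_inf_dual: "positive f \<Longrightarrow> positive g \<Longrightarrow> valid_inf (dual g) (dual f) \<longleftrightarrow> valid_inf f g"
proof -
  have *: "valid_inf (dual g) (dual f)" if "positive f" "positive g" "valid_inf f g" for f g
    using that by (auto simp: valid_inf_def eval_dual)
  assume "positive f" "positive g"
  then show ?thesis using *[of f g] *[of "dual g" "dual f"] by auto
qed

lemma nontrivial_inf_dual:
  assumes "nontrivial_inf f g" shows "nontrivial_inf (dual g) (dual f)"
  unfolding nontrivial_inf_def
proof (intro conjI ballI)
  have pos: "positive f" "positive g" "vars f = vars g" "valid_inf f g"
    using assms by (simp_all add: nontrivial_inf_def)
  then show "positive (dual g)" "positive (dual f)" "vars (dual g) = vars (dual f)"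
    by simp_all
  show "valid_inf (dual g) (dual f)" using pos by (simp add: valid_inf_dual)
  fix x assume "x \<in> vars (dual g)"
  then have "x \<in> vars f" using pos by simp
  then obtain v where v: "eval (v(x := True)) f" "\<not> eval (v(x := False)) g"
    using assms unfolding nontrivial_inf_def by blast
  define w where "w = (\<lambda>y. \<not> v y)"
  have e: "(\<lambda>y. \<not> (w(x := True)) y) = v(x := False)" "(\<lambda>y. \<not> (w(x := False)) y) = v(x := True)"
    by (simp_all add: fun_eq_iff w_def)
  have "eval (w(x := True)) (dual g)" using v(2) unfolding eval_dual[OF pos(2)] e .
  moreover have "\<not> eval (w(x := False)) (dual f)" using v(1) unfolding eval_dual[OF pos(1)] e by simp
  ultimately show "\<exists>v. eval (v(x := True)) (dual g) \<and> \<not> eval (v(x := False)) (dual f)" by blast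
qed

text \<open>The old witnesses still work: \<open>f'\<close> is weaker than \<open>f\<close>, so it
  stays true, and \<open>g'\<close> is stronger than \<open>g\<close>, so it stays false.\<close>

lemma nontrivial_inf_between:
  assumes "nontrivial_inf f g" "valid_inf f f'" "valid_inf f' g'" "valid_inf g' g"
    "positive f'" "positive g'" "vars f' = vars f" "vars g' = vars g"
  shows "nontrivial_inf f' g'"
  unfolding nontrivial_inf_def
proof (intro conjI ballI)
  fix x assume "x \<in> vars f'"
  then obtain v where "eval (v(x := True)) f" "\<not> eval (v(x := False)) g"
    using assms(1,7) unfolding nontrivial_inf_def by blast
  then show "\<exists>v. eval (v(x := True)) f' \<and> \<not> eval (v(x := False)) g'"
    using assms(2,4) unfolding valid_inf_def by blast
qed (use assms in \<open>auto simp: nontrivial_inf_def\<close>)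

lemma der_valid: "der a b \<Longrightarrow> valid_inf a b"
  by (simp add: valid_inf_def der_eval)

lemma valid_inf_trans: "valid_inf a b \<Longrightarrow> valid_inf b c \<Longrightarrow> valid_inf a c"
  by (simp add: valid_inf_def)

lemma nontrivial_inf_der_left:
  "nontrivial_inf f g \<Longrightarrow> der f f' \<Longrightarrow> valid_inf f' g \<Longrightarrow> nontrivial_inf f' g"
  using nontrivial_inf_between[of f g f' g] der_valid der_vars der_positive
  by (auto simp: nontrivial_inf_def valid_inf_def)

lemma ac_valid: "ac a b \<Longrightarrow> valid_inf a b \<and> valid_inf b a"
  by (simp add: valid_inf_def ac_eval)

lemma nontrivial_inf_ac:
  assumes "nontrivial_inf f g" "ac f f'" "ac g g'" shows "nontrivial_inf f' g'"
proof -
  have "valid_inf f' g'"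
    using assms unfolding nontrivial_inf_def by (metis ac_valid valid_inf_trans)
  then show ?thesis using assms ac_valid ac_vars ac_positive
    by (intro nontrivial_inf_between[OF assms(1)]) (auto simp: nontrivial_inf_def)
qed

subsection \<open>Splitting a conjunctive conclusion by medial\<close>

text \<open>What non-triviality of an inference from \<open>f\<close> to \<open>And p q\<close>
  leaves on \<open>f\<close>, with \<open>U = vars p\<close> and \<open>W = vars q\<close>: making
  \<open>W\<close> true settles \<open>q\<close>, and each variable of \<open>U\<close> can still
  decide \<open>f\<close>.\<close>

definition sensitive :: "form \<Rightarrow> nat set \<Rightarrow> nat set \<Rightarrow> bool" where
  "sensitive f U W \<longleftrightarrow>
     (\<forall>x \<in> vars f \<inter> U. \<exists>v. (\<forall>y \<in> W. v y) \<and> eval (v(x := True)) f \<and> \<not> eval (v(x := False)) f)"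

lemma eval_upd_notin: "x \<notin> vars f \<Longrightarrow> eval (v(x := b)) f = eval v f"
  by (rule eval_cong_vars) auto

text \<open>By linearity \<open>x\<close> occurs on one side only, so a flip of \<open>x\<close>
  that changes \<open>f\<close> must change that side.\<close>

lemma sensitive_connective:
  assumes "positive a" "positive b" "vars a \<inter> vars b = {}" "f = And a b \<or> f = Or a b" "sensitive f U W"
  shows "sensitive a U W \<and> sensitive b U W"
proof -
  have "\<exists>v. (\<forall>y \<in> W. v y) \<and> eval (v(x := True)) c \<and> \<not> eval (v(x := False)) c"
    if c: "c = a \<or> c = b" and x: "x \<in> vars c" "x \<in> U" for c x
  proof -
    have "x \<in> vars f" using c x assms(4) by auto
    then obtain v where v: "\<forall>y \<in> W. v y" "eval (v(x := True)) f" "\<not> eval (v(x := False)) f"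
      using assms(5) x(2) unfolding sensitive_def by blast
    have "c = a \<Longrightarrow> eval (v(x := True)) b = eval (v(x := False)) b"
      "c = b \<Longrightarrow> eval (v(x := True)) a = eval (v(x := False)) a"
      using x(1) assms(3) by (auto intro!: eval_cong_vars)
    then show ?thesis using v c assms(4) by auto
  qed
  then show ?thesis unfolding sensitive_def by blast
qed

lemma sensitive_And: "positive (And a b) \<Longrightarrow> sensitive (And a b) U W \<Longrightarrow> sensitive a U W \<and> sensitive b U W"
  by (rule sensitive_connective[of a b "And a b"]) auto

lemma sensitive_Or: "positive (Or a b) \<Longrightarrow> sensitive (Or a b) U W \<Longrightarrow> sensitive a U W \<and> sensitive b U W"
  by (rule sensitive_connective[of a b "Or a b"]) auto

text \<open>The last line makes \<open>g\<close> and \<open>h\<close> equivalent to \<open>f\<close>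
  with \<open>W\<close>, respectively \<open>U\<close>, set to true. Validity and witnesses are
  transferred through these two clauses.\<close>

definition splits_into :: "form \<Rightarrow> nat set \<Rightarrow> nat set \<Rightarrow> form \<Rightarrow> form \<Rightarrow> bool" where
  "splits_into f U W g h \<longleftrightarrow> positive g \<and> positive h \<and> vars g = vars f \<inter> U \<and> vars h = vars f \<inter> W \<and>
     der f (And g h) \<and>
     (\<forall>v. (\<forall>y \<in> W. v y) \<longrightarrow> eval v g = eval v f) \<and> (\<forall>v. (\<forall>y \<in> U. v y) \<longrightarrow> eval v h = eval v f)"

text \<open>With \<open>W\<close> true the disjunct \<open>a\<close> is true, and no variable of
  \<open>b\<close> can influence the disjunction any more.\<close>

lemma sensitive_Or_cover:
  assumes "positive (Or a b)" "sensitive (Or a b) U W" "vars a \<subseteq> W"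
  shows "vars b \<inter> U = {}"
proof (rule ccontr)
  assume "vars b \<inter> U \<noteq> {}"
  then obtain x where x: "x \<in> vars b" "x \<in> U" by blast
  then obtain v where v: "\<forall>y \<in> W. v y" "\<not> eval (v(x := False)) (Or a b)"
    using assms(2) unfolding sensitive_def by auto
  have "x \<notin> vars a" using assms(1) x by auto
  then have "eval (v(x := False)) a" using assms v(1) by (intro eval_all_true) auto
  then show False using v(2) by simp
qed

lemma ac_and_lcomm: "ac (And a (And b c)) (And b (And a c))"
  by (rule ac_trans[OF ac_sym[OF ac_and_assoc] ac_trans[OF ac_and[OF ac_and_comm ac_refl] ac_and_assoc]])

lemma ac_and_rcomm: "ac (And (And a b) c) (And (And a c) b)"
  by (rule ac_trans[OF ac_and_assoc ac_trans[OF ac_and[OF ac_refl ac_and_comm] ac_sym[OF ac_and_assoc]]])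

lemma ac_and_swap: "ac (And (And a b) (And c d)) (And (And a c) (And b d))"
  by (rule ac_trans[OF ac_and_assoc ac_trans[OF ac_and[OF ac_refl ac_and_lcomm] ac_sym[OF ac_and_assoc]]])

lemma splits_into_der: "splits_into f U W g h \<Longrightarrow> der f (And g h)"
  by (simp add: splits_into_def)

text \<open>Medial and the cover lemma enter only at disjunctions: a one-coloured disjunct forces
  its colour on the other one; otherwise both disjuncts split and medial merges the splits.
  Conjunctions are merely regrouped.\<close>

lemma medial_split:
  assumes "positive f" "vars f \<subseteq> U \<union> W" "U \<inter> W = {}" "sensitive f U W" "sensitive f W U"
  shows "vars f \<subseteq> U \<or> vars f \<subseteq> W \<or> (\<exists>g h. splits_into f U W g h)"
  using assms
proof (induction f)
  case (And a b)
  have IHa: "vars a \<subseteq> U \<or> vars a \<subseteq> W \<or> (\<exists>g h. splits_into a U W g h)"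
    and IHb: "vars b \<subseteq> U \<or> vars b \<subseteq> W \<or> (\<exists>g h. splits_into b U W g h)"
    using And sensitive_And by auto
  have pos: "positive a" "positive b" "vars a \<inter> vars b = {}" using And.prems by auto
  have tr: "eval v f" if "positive f" "vars f \<subseteq> Z" "\<forall>y \<in> Z. v y" for v f Z
    using that by (intro eval_all_true) auto
  \<comment> \<open>Facts 1 to 7 treat all pairs of types (inside \<open>U\<close>, inside
    \<open>W\<close>, split) of \<open>a\<close> and \<open>b\<close> except the two one-coloured
    pairs.\<close>
  have 1: "splits_into (And a b) U W a b" if "vars a \<subseteq> U" "vars b \<subseteq> W"
    using that And.prems pos unfolding splits_into_def by (auto simp: tr)
  have 2: "splits_into (And a b) U W b a" if "vars a \<subseteq> W" "vars b \<subseteq> U"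
    using that And.prems pos der_ac[OF ac_and_comm] unfolding splits_into_def by (auto simp: tr)
  have 3: "splits_into (And a b) U W (And a g) h" if "vars a \<subseteq> U" "splits_into b U W g h" for g h
  proof -
    have "der (And a b) (And a (And g h))" by (rule der_and[OF rtranclp.rtrancl_refl splits_into_der[OF that(2)]])
    also have "der \<dots> (And (And a g) h)" by (rule der_ac, rule ac_sym, rule ac_and_assoc)
    finally show ?thesis using that And.prems pos unfolding splits_into_def by (auto simp: tr)
  qed
  have 4: "splits_into (And a b) U W g (And a h)" if "vars a \<subseteq> W" "splits_into b U W g h" for g h
  proof -
    have "der (And a b) (And a (And g h))" by (rule der_and[OF rtranclp.rtrancl_refl splits_into_der[OF that(2)]])
    also have "der \<dots> (And g (And a h))" by (rule der_ac, rule ac_and_lcomm)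
    finally show ?thesis using that And.prems pos unfolding splits_into_def by (auto simp: tr)
  qed
  have 5: "splits_into (And a b) U W (And g b) h" if "vars b \<subseteq> U" "splits_into a U W g h" for g h
  proof -
    have "der (And a b) (And (And g h) b)" by (rule der_and[OF splits_into_der[OF that(2)] rtranclp.rtrancl_refl])
    also have "der \<dots> (And (And g b) h)" by (rule der_ac, rule ac_and_rcomm)
    finally show ?thesis using that And.prems pos unfolding splits_into_def by (auto simp: tr)
  qed
  have 6: "splits_into (And a b) U W g (And h b)" if "vars b \<subseteq> W" "splits_into a U W g h" for g h
  proof -
    have "der (And a b) (And (And g h) b)" by (rule der_and[OF splits_into_der[OF that(2)] rtranclp.rtrancl_refl])
    also have "der \<dots> (And g (And h b))" by (rule der_ac, rule ac_and_assoc)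
    finally show ?thesis using that And.prems pos unfolding splits_into_def by (auto simp: tr)
  qed
  have 7: "splits_into (And a b) U W (And g g') (And h h')" if "splits_into a U W g h" "splits_into b U W g' h'" for g h g' h'
  proof -
    have "der (And a b) (And (And g h) (And g' h'))" by (rule der_and[OF splits_into_der[OF that(1)] splits_into_der[OF that(2)]])
    also have "der \<dots> (And (And g g') (And h h'))" by (rule der_ac, rule ac_and_swap)
    finally show ?thesis using that And.prems pos unfolding splits_into_def by auto
  qed
  have "vars (And a b) \<subseteq> U \<longleftrightarrow> vars a \<subseteq> U \<and> vars b \<subseteq> U"
    "vars (And a b) \<subseteq> W \<longleftrightarrow> vars a \<subseteq> W \<and> vars b \<subseteq> W" by auto
  moreover have "\<exists>g h. splits_into (And a b) U W g h" if "vars a \<subseteq> U" "vars b \<subseteq> W"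
    using 1 that by blast
  moreover have "\<exists>g h. splits_into (And a b) U W g h" if "vars a \<subseteq> W" "vars b \<subseteq> U"
    using 2 that by blast
  moreover have "\<exists>g h. splits_into (And a b) U W g h" if "vars a \<subseteq> U" "\<exists>g h. splits_into b U W g h"
    using 3 that by blast
  moreover have "\<exists>g h. splits_into (And a b) U W g h" if "vars a \<subseteq> W" "\<exists>g h. splits_into b U W g h"
    using 4 that by blast
  moreover have "\<exists>g h. splits_into (And a b) U W g h" if "vars b \<subseteq> U" "\<exists>g h. splits_into a U W g h"
    using 5 that by blast
  moreover have "\<exists>g h. splits_into (And a b) U W g h" if "vars b \<subseteq> W" "\<exists>g h. splits_into a U W g h"
    using 6 that by blast
  moreover have "\<exists>g h. splits_into (And a b) U W g h" if "\<exists>g h. splits_into a U W g h" "\<exists>g h. splits_into b U W g h"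
    using 7 that by blast
  ultimately show ?case using IHa IHb by satx
next
  case (Or a b)
  have IHa: "vars a \<subseteq> U \<or> vars a \<subseteq> W \<or> (\<exists>g h. splits_into a U W g h)"
    and IHb: "vars b \<subseteq> U \<or> vars b \<subseteq> W \<or> (\<exists>g h. splits_into b U W g h)"
    using Or sensitive_Or by auto
  have pos: "positive a" "positive b" "vars a \<inter> vars b = {}" using Or.prems by auto
  have pos': "positive (Or b a)" using pos by auto
  have s': "sensitive (Or b a) U W" "sensitive (Or b a) W U"
    using Or.prems(4,5) unfolding sensitive_def by (auto simp: Un_commute disj_commute)
  note c = sensitive_Or_cover[OF Or.prems(1) Or.prems(4)] sensitive_Or_cover[OF Or.prems(1) Or.prems(5)]
    sensitive_Or_cover[OF pos' s'(1)] sensitive_Or_cover[OF pos' s'(2)]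
  have sub: "vars a \<subseteq> U \<union> W" "vars b \<subseteq> U \<union> W" using Or.prems(2) by auto
  have mono: "vars (Or a b) \<subseteq> U \<or> vars (Or a b) \<subseteq> W"
    if "vars a \<subseteq> U \<or> vars a \<subseteq> W \<or> vars b \<subseteq> U \<or> vars b \<subseteq> W"
  proof -
    have "vars a \<subseteq> U \<Longrightarrow> vars b \<subseteq> U" "vars a \<subseteq> W \<Longrightarrow> vars b \<subseteq> W"
      "vars b \<subseteq> U \<Longrightarrow> vars a \<subseteq> U" "vars b \<subseteq> W \<Longrightarrow> vars a \<subseteq> W"
      using c sub by blast+
    then show ?thesis using that by auto
  qed
  have 7: "splits_into (Or a b) U W (Or g g') (Or h h')" if "splits_into a U W g h" "splits_into b U W g' h'" for g h g' h'
  proof -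
    have "der (Or a b) (Or (And g h) (And g' h'))" by (rule der_or[OF splits_into_der[OF that(1)] splits_into_der[OF that(2)]])
    also have "der \<dots> (And (Or g g') (Or h h'))" by (intro der_step step_medial)
    finally show ?thesis using that Or.prems pos unfolding splits_into_def by auto
  qed
  have "\<exists>g h. splits_into (Or a b) U W g h" if "\<exists>g h. splits_into a U W g h" "\<exists>g h. splits_into b U W g h"
    using 7 that by blast
  then show ?case using IHa IHb mono by satx
qed auto

lemma nontrivial_inf_And_split:
  assumes "nontrivial_inf f (And p q)"
  obtains g h where "der f (And g h)" "nontrivial_inf g p" "nontrivial_inf h q"
proof -
  let ?U = "vars p" and ?W = "vars q"
  have pos: "positive f" "positive p" "positive q" "?U \<inter> ?W = {}" "vars f = ?U \<union> ?W"
    and val: "\<And>v. eval v f \<Longrightarrow> eval v p \<and> eval v q"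
    using assms by (auto simp: nontrivial_inf_def valid_inf_def)
  have wit: "\<exists>v. (\<forall>y \<in> Z'. v y) \<and> eval (v(x := True)) f \<and> \<not> eval (v(x := False)) r"
    if x: "x \<in> vars r" and r: "r = p \<and> Z' = ?W \<or> r = q \<and> Z' = ?U" for x r Z'
  proof -
    obtain v where v: "eval (v(x := True)) f" "\<not> eval (v(x := False)) (And p q)"
      using assms x r pos unfolding nontrivial_inf_def by (metis UnCI)
    \<comment> \<open>At \<open>x := True\<close> both \<open>p\<close> and \<open>q\<close> hold;
      the one without \<open>x\<close> survives the flip, so \<open>r\<close> is what fails. Raising
      \<open>Z'\<close> to true then keeps \<open>f\<close> by monotonicity and does not touch
      \<open>r\<close>.\<close>
    have nr: "\<not> eval (v(x := False)) r"
      using v val[OF v(1)] x r pos by (auto simp: eval_upd_notin disjoint_iff)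
    let ?w = "\<lambda>y. v y \<or> y \<in> Z'"
    have xZ: "x \<notin> Z'" using x r pos by auto
    have "eval (?w(x := True)) f" by (rule eval_mono[OF pos(1) v(1)]) auto
    moreover have "eval (?w(x := False)) r = eval (v(x := False)) r"
      using r pos by (intro eval_cong_vars) auto
    ultimately show ?thesis using nr by (intro exI[of _ ?w]) auto
  qed
  have "sensitive f ?U ?W" "sensitive f ?W ?U"
    unfolding sensitive_def using wit[of _ p ?W] wit[of _ q ?U] val by blast+
  moreover have "\<not> vars f \<subseteq> ?U" "\<not> vars f \<subseteq> ?W"
    using pos vars_nonempty[of p] vars_nonempty[of q] by auto
  ultimately obtain g h where s: "splits_into f ?U ?W g h"
    using medial_split[of f ?U ?W] pos by auto
  have vg: "vars g = ?U" "vars h = ?W" and pg: "positive g" "positive h" "der f (And g h)"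
    and eg: "\<And>v. (\<forall>y \<in> ?W. v y) \<Longrightarrow> eval v g = eval v f"
      "\<And>v. (\<forall>y \<in> ?U. v y) \<Longrightarrow> eval v h = eval v f"
    using s pos by (auto simp: splits_into_def)
  have 1: "nontrivial_inf g p" unfolding nontrivial_inf_def
  proof (intro conjI ballI)
    show "valid_inf g p" unfolding valid_inf_def
    proof (intro allI impI)
      fix v assume v: "eval v g"
      \<comment> \<open>Neither \<open>g\<close> nor \<open>p\<close> sees \<open>W\<close>, and
        once \<open>W\<close> is true \<open>g\<close> agrees with \<open>f\<close>.\<close>
      let ?w = "\<lambda>y. v y \<or> y \<in> ?W"
      have "eval ?w g" using eval_cong_vars[of g v ?w] v vg pos(4) by auto
      then have "eval ?w p" using eg(1)[of ?w] val by auto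
      then show "eval v p" using eval_cong_vars[of p v ?w] pos(4) by auto
    qed
  next
    fix x assume "x \<in> vars g"
    then have x: "x \<in> ?U" using vg by simp
    then obtain v where v: "\<forall>y \<in> ?W. v y" "eval (v(x := True)) f" "\<not> eval (v(x := False)) p"
      using wit[of x p ?W] by blast
    then have "eval (v(x := True)) g" using eg(1)[of "v(x := True)"] by auto
    with v show "\<exists>v. eval (v(x := True)) g \<and> \<not> eval (v(x := False)) p" by blast
  qed (use pg pos vg in auto)
  have 2: "nontrivial_inf h q" unfolding nontrivial_inf_def
  proof (intro conjI ballI)
    show "valid_inf h q" unfolding valid_inf_def
    proof (intro allI impI)
      fix v assume v: "eval v h"
      let ?w = "\<lambda>y. v y \<or> y \<in> ?U"
      have "eval ?w h" using eval_cong_vars[of h v ?w] v vg pos(4) by auto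
      then have "eval ?w q" using eg(2)[of ?w] val by auto
      then show "eval v q" using eval_cong_vars[of q v ?w] pos(4) by auto
    qed
  next
    fix x assume "x \<in> vars h"
    then have x: "x \<in> ?W" using vg by simp
    then obtain v where v: "\<forall>y \<in> ?U. v y" "eval (v(x := True)) f" "\<not> eval (v(x := False)) q"
      using wit[of x q ?U] by blast
    then have "eval (v(x := True)) h" using eg(2)[of "v(x := True)"] by auto
    with v show "\<exists>v. eval (v(x := True)) h \<and> \<not> eval (v(x := False)) q" by blast
  qed (use pg pos vg in auto)
  from that pg(3) 1 2 show ?thesis by blast
qed

subsection \<open>Two conjuncts against two disjuncts\<close>

text \<open>
  Here \<open>A i k\<close> is the \<open>k\<close>-th disjunct of the \<open>i\<close>-th conjunct of the premise, as a function of the set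
  of true variables, and \<open>B j l\<close> the \<open>l\<close>-th conjunct of the \<open>j\<close>-th disjunct of the conclusion; the
  variables of \<open>A i k\<close> are those with \<open>ai x = i\<close> and \<open>ak x = k\<close>, similarly for \<open>B\<close>. The set \<open>P i k\<close>
  witnesses that \<open>A i k\<close> does not imply the conclusion, and \<open>T j l\<close>, a set of false variables, that
  the premise does not imply \<open>B j l\<close>. With fewer than eight variables some \<open>P i k\<close> and some \<open>T j l\<close>
  are singletons; in each relative position of the two, eight different variables can be exhibited.
\<close>

locale two_by_two =
  fixes A B :: "bool \<Rightarrow> bool \<Rightarrow> nat set \<Rightarrow> bool"
    and ai ak bj bl :: "nat \<Rightarrow> bool"
    and P T :: "bool \<Rightarrow> bool \<Rightarrow> nat set" and V :: "nat set"
  assumes finV: "finite V" and card_V: "card V < 8"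
    and A_mono: "A i k X \<Longrightarrow> (\<And>x. x \<in> X \<Longrightarrow> x \<in> V \<Longrightarrow> ai x = i \<Longrightarrow> ak x = k \<Longrightarrow> x \<in> Y) \<Longrightarrow> A i k Y"
    and B_mono: "B j l X \<Longrightarrow> (\<And>x. x \<in> X \<Longrightarrow> x \<in> V \<Longrightarrow> bj x = j \<Longrightarrow> bl x = l \<Longrightarrow> x \<in> Y) \<Longrightarrow> B j l Y"
    and A_empty: "\<not> A i k {}" and B_UNIV: "B j l UNIV"
    and imp: "(\<And>i. \<exists>k. A i k X) \<Longrightarrow> \<exists>j. \<forall>l. B j l X"
    and P_loc: "x \<in> P i k \<Longrightarrow> x \<in> V \<and> ai x = i \<and> ak x = k"
    and T_loc: "x \<in> T j l \<Longrightarrow> x \<in> V \<and> bj x = j \<and> bl x = l"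
    and P_true: "A i k (P i k)" and P_neg: "\<exists>l. \<not> B j l (P i k)"
    and T_false: "\<not> B j l (- T j l)" and T_neg: "\<exists>k. A i k (- T j l)"
begin

lemma no_eight: "distinct xs \<Longrightarrow> set xs \<subseteq> V \<Longrightarrow> length xs < 8"
  using card_mono[OF finV, of "set xs"] card_V by (simp add: distinct_card)

text \<open>Otherwise \<open>X\<close>, restricted to the block of \<open>A i k\<close>, would lie
  in \<open>- Y\<close>, against monotonicity. Many of the eight variables are meeting points of
  this kind.\<close>

lemma A_meet: "A i k X \<Longrightarrow> \<not> A i k (- Y) \<Longrightarrow> \<exists>x. x \<in> X \<and> x \<in> Y \<and> x \<in> V \<and> ai x = i \<and> ak x = k"
  using A_mono[of i k X "- Y"] by auto

lemma B_meet: "B j l X \<Longrightarrow> \<not> B j l (- Y) \<Longrightarrow> \<exists>x. x \<in> X \<and> x \<in> Y \<and> x \<in> V \<and> bj x = j \<and> bl x = l"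
  using B_mono[of j l X "- Y"] by auto

text \<open>One \<open>P\<close> from each conjunct satisfies the premise.\<close>

lemma P_union: "\<exists>j. \<forall>l. B j l (P i k \<union> P (\<not> i) k')"
proof (rule imp)
  fix i0
  show "\<exists>k0. A i0 k0 (P i k \<union> P (\<not> i) k')"
  proof (cases "i0 = i")
    case True
    then show ?thesis using A_mono[OF P_true[of i k]] by blast
  next
    case False
    then have "i0 = (\<not> i)" by simp
    then show ?thesis using A_mono[OF P_true[of "\<not> i" k']] by blast
  qed
qed

text \<open>Contraposition: making one \<open>T\<close> from each disjunct false refutes the
  conclusion.\<close>

lemma T_union: "\<exists>i. \<forall>k. \<not> A i k (- (T j l \<union> T (\<not> j) l'))"
proof (rule ccontr)
  assume "\<not> ?thesis"
  then obtain j0 where j0: "\<And>l0. B j0 l0 (- (T j l \<union> T (\<not> j) l'))"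
    using imp[of "- (T j l \<union> T (\<not> j) l')"] by auto
  show False
  proof (cases "j0 = j")
    case True
    have "B j l (- T j l)" by (rule B_mono[OF j0[of l, unfolded True]]) auto
    then show ?thesis using T_false by blast
  next
    case False
    then have "j0 = (\<not> j)" by simp
    note j0 = j0[of l', unfolded this]
    have "B (\<not> j) l' (- T (\<not> j) l')" by (rule B_mono[OF j0]) auto
    then show ?thesis using T_false by blast
  qed
qed

lemma P_extra:
  assumes "B j l (X \<union> P i k)" "\<not> B j l X"
  obtains x where "x \<in> P i k" "bj x = j" "bl x = l"
  using assms B_mono[of j l "X \<union> P i k" X] by blast

lemma T_extra:
  assumes "\<not> A i k (- (X \<union> T j l))" "A i k (- X)"
  obtains x where "x \<in> T j l" "ai x = i" "ak x = k"
  using assms A_mono[of i k "- X" "- (X \<union> T j l)"] by blast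

text \<open>The four sets are nonempty by \<open>A_empty\<close> and lie in disjoint blocks; with
  two elements each they would use eight variables.\<close>

lemma singleton_P: "\<exists>i k a. P i k = {a}"
proof (rule ccontr)
  assume n: "\<not> ?thesis"
  have "\<exists>x y. x \<in> P i k \<and> y \<in> P i k \<and> x \<noteq> y" for i k
  proof -
    have "P i k \<noteq> {}" using P_true[of i k] A_empty[of i k] by auto
    then obtain x where "x \<in> P i k" by blast
    moreover have "P i k \<noteq> {x}" using n by blast
    ultimately show ?thesis by blast
  qed
  then obtain f g where f: "\<And>i k. f i k \<in> P i k \<and> g i k \<in> P i k \<and> f i k \<noteq> g i k" by metis
  let ?xs = "[f True True, g True True, f True False, g True False,
    f False True, g False True, f False False, g False False]"
  have loc: "f i k \<in> V \<and> ai (f i k) = i \<and> ak (f i k) = k \<and> g i k \<in> V \<and> ai (g i k) = i \<and> ak (g i k) = k" for i k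
    using f[of i k] P_loc by blast
  have "u \<noteq> w" if "ai u \<noteq> ai w \<or> ak u \<noteq> ak w" for u w using that by auto
  then have "distinct ?xs" using f loc by simp
  moreover have "set ?xs \<subseteq> V" using loc by simp
  ultimately show False using no_eight[of ?xs] by simp
qed

lemma singleton_T: "\<exists>j l t. T j l = {t}"
proof (rule ccontr)
  assume n: "\<not> ?thesis"
  have "\<exists>x y. x \<in> T j l \<and> y \<in> T j l \<and> x \<noteq> y" for j l
  proof -
    have "T j l \<noteq> {}" using T_false[of j l] B_UNIV[of j l] by auto
    then obtain x where "x \<in> T j l" by blast
    moreover have "T j l \<noteq> {x}" using n by blast
    ultimately show ?thesis by blast
  qed
  then obtain f g where f: "\<And>i k. f i k \<in> T i k \<and> g i k \<in> T i k \<and> f i k \<noteq> g i k" by metis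
  let ?xs = "[f True True, g True True, f True False, g True False,
    f False True, g False True, f False False, g False False]"
  have loc: "f i k \<in> V \<and> bj (f i k) = i \<and> bl (f i k) = k \<and> g i k \<in> V \<and> bj (g i k) = i \<and> bl (g i k) = k" for i k
    using f[of i k] T_loc by blast
  have "u \<noteq> w" if "bj u \<noteq> bj w \<or> bl u \<noteq> bl w" for u w using that by auto
  then have "distinct ?xs" using f loc by simp
  moreover have "set ?xs \<subseteq> V" using loc by simp
  ultimately show False using no_eight[of ?xs] by simp
qed

lemma contradiction: False
proof -
  obtain i k a where Pa: "P i k = {a}" using singleton_P by blast
  define j l where "j = bj a" and "l = bl a"
  have a: "a \<in> V" "ai a = i" "ak a = k" "bj a = j" "bl a = l"
    using P_loc[of a i k] Pa by (auto simp: j_def l_def)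
  have aT: "a \<notin> T j' l'" if "j' \<noteq> j \<or> l' \<noteq> l" for j' l' using T_loc[of a j' l'] a that by auto
  \<comment> \<open>Some disjunct \<open>j0\<close> becomes true. If it did not contain
    \<open>a\<close>, the set \<open>P (\<not> i) \<kappa>\<close> alone would satisfy it, against
    \<open>P_neg\<close>.\<close>
  have F1: "B j l0 (P i k \<union> P (\<not> i) \<kappa>)" for l0 \<kappa>
  proof -
    obtain j0 where j0: "\<And>l. B j0 l (P i k \<union> P (\<not> i) \<kappa>)" using P_union[of i k \<kappa>] by blast
    have "j0 = j"
    proof (rule ccontr)
      assume ne: "j0 \<noteq> j"
      have "B j0 l (P (\<not> i) \<kappa>)" for l
        by (rule B_mono[OF j0[of l]]) (use Pa a ne in auto)
      then show False using P_neg by blast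
    qed
    then show ?thesis using j0 by simp
  qed
  have F2: "B j (\<not> l) (P (\<not> i) \<kappa>)" for \<kappa>
    by (rule B_mono[OF F1[of "\<not> l" \<kappa>]]) (use Pa a in auto)
  \<comment> \<open>\<open>P (\<not> i) \<kappa>\<close> has to fail in disjunct \<open>j\<close>,
    and F2 leaves only the conjunct of \<open>a\<close>.\<close>
  have F3: "\<not> B j l (P (\<not> i) \<kappa>)" for \<kappa>
  proof -
    obtain m where m: "\<not> B j m (P (\<not> i) \<kappa>)" using P_neg by blast
    have "m \<noteq> (\<not> l)"
    proof
      assume e: "m = (\<not> l)"
      show False using m[unfolded e] F2 by blast
    qed
    then have "m = l" by simp
    then show ?thesis using m by simp
  qed
  have "\<exists>x. x \<in> P (\<not> i) \<kappa> \<and> x \<in> T j (\<not> l)" for \<kappa>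
    using B_meet[OF F2 T_false] by blast
  then obtain b where b: "\<And>\<kappa>. b \<kappa> \<in> P (\<not> i) \<kappa> \<and> b \<kappa> \<in> T j (\<not> l)" by metis
  have b_loc: "b \<kappa> \<in> V \<and> ai (b \<kappa>) = (\<not> i) \<and> ak (b \<kappa>) = \<kappa> \<and> bj (b \<kappa>) = j \<and> bl (b \<kappa>) = (\<not> l)" for \<kappa>
    using b[of \<kappa>] P_loc T_loc by blast
  obtain j' l' t where Tt: "T j' l' = {t}" using singleton_T by blast
  have t: "t \<in> V" "bj t = j'" "bl t = l'" using T_loc[of t j' l'] Tt by auto
  have neq: "u \<noteq> w" if "ai u \<noteq> ai w \<or> ak u \<noteq> ak w \<or> bj u \<noteq> bj w \<or> bl u \<noteq> bl w" for u w
    using that by auto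
  consider (same) "j' = j" "l' = l" | (opp) "j' = j" "l' = (\<not> l)" | (other) "j' = (\<not> j)" by blast
  then show False
  proof cases
    case opp
    \<comment> \<open>\<open>b True\<close> and \<open>b False\<close> are different elements of the
      singleton \<open>T j (\<not> l)\<close>.\<close>
    then show False using b[of True] b[of False] b_loc[of True] b_loc[of False] Tt by auto
  next
    case same
    \<comment> \<open>The sets \<open>P (\<not> i) True\<close> and
      \<open>P (\<not> i) False\<close> are disjoint, so \<open>t\<close> can only be
      \<open>a\<close>.\<close>
    have "t \<in> P i k \<union> P (\<not> i) \<kappa>" for \<kappa>
      using B_meet[OF F1[of l \<kappa>] T_false] Tt same by auto
    then have "t = a"
      using P_loc[of t "\<not> i" True] P_loc[of t "\<not> i" False] Pa by (metis UnE singletonD)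
    then have Ta: "T j l = {a}" using Tt same by simp
    \<comment> \<open>Since \<open>T (\<not> j) \<mu>\<close> refutes no conjunct and
      \<open>a\<close> affects only conjunct \<open>i\<close>, the union refutes conjunct
      \<open>i\<close>; the disjunct without \<open>a\<close> is then refuted by
      \<open>T (\<not> j) \<mu>\<close> alone.\<close>
    have "\<exists>x. x \<in> P i (\<not> k) \<and> x \<in> T (\<not> j) \<mu>" for \<mu>
    proof -
      obtain i0 where i0: "\<And>k0. \<not> A i0 k0 (- (T j l \<union> T (\<not> j) \<mu>))" using T_union[of j l \<mu>] by blast
      obtain k0 where k0: "A i0 k0 (- T (\<not> j) \<mu>)" using T_neg by blast
      have "i0 = i"
      proof (rule ccontr)
        assume ne: "i0 \<noteq> i"
        have "A i0 k0 (- (T j l \<union> T (\<not> j) \<mu>))"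
          by (rule A_mono[OF k0]) (use Ta a ne in auto)
        then show False using i0 by blast
      qed
      have "\<not> A i (\<not> k) (- T (\<not> j) \<mu>)"
      proof
        assume "A i (\<not> k) (- T (\<not> j) \<mu>)"
        then have "A i (\<not> k) (- (T j l \<union> T (\<not> j) \<mu>))"
          by (rule A_mono) (use Ta a in auto)
        then show False using i0 \<open>i0 = i\<close> by blast
      qed
      then show ?thesis using A_meet[OF P_true] by blast
    qed
    then obtain c where c: "\<And>\<mu>. c \<mu> \<in> P i (\<not> k) \<and> c \<mu> \<in> T (\<not> j) \<mu>" by metis
    have c_loc: "c \<mu> \<in> V \<and> ai (c \<mu>) = i \<and> ak (c \<mu>) = (\<not> k) \<and> bj (c \<mu>) = (\<not> j) \<and> bl (c \<mu>) = \<mu>" for \<mu>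
      using c[of \<mu>] P_loc T_loc by blast
    obtain m where m: "\<not> B (\<not> j) m (P i (\<not> k))" using P_neg by blast
    \<comment> \<open>Without \<open>a\<close> the disjunct \<open>j\<close> is false, because
      \<open>T j l = {a}\<close>. So disjunct \<open>\<not> j\<close> is satisfied, and
      \<open>P (\<not> i) \<kappa>\<close> has to supply what \<open>P i (\<not> k)\<close> lacks in
      conjunct \<open>m\<close>.\<close>
    have "\<exists>x. x \<in> P (\<not> i) \<kappa> \<and> bj x = (\<not> j) \<and> bl x = m" for \<kappa>
    proof -
      obtain j0 where j0: "\<And>l. B j0 l (P i (\<not> k) \<union> P (\<not> i) \<kappa>)" using P_union[of i "\<not> k" \<kappa>] by blast
      have nin: "a \<notin> P i (\<not> k) \<union> P (\<not> i) \<kappa>" using P_loc[of a i "\<not> k"] P_loc[of a "\<not> i" \<kappa>] a by auto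
      have "j0 \<noteq> j"
      proof
        assume e: "j0 = j"
        show False using B_meet[OF j0[of l, unfolded e] T_false] Ta nin by auto
      qed
      then have "j0 = (\<not> j)" by simp
      then show ?thesis using P_extra[OF j0[of m, unfolded \<open>j0 = (\<not> j)\<close>] m] by blast
    qed
    then obtain e where e: "\<And>\<kappa>. e \<kappa> \<in> P (\<not> i) \<kappa> \<and> bj (e \<kappa>) = (\<not> j) \<and> bl (e \<kappa>) = m" by metis
    have e_loc: "e \<kappa> \<in> V \<and> ai (e \<kappa>) = (\<not> i) \<and> ak (e \<kappa>) = \<kappa> \<and> bj (e \<kappa>) = (\<not> j) \<and> bl (e \<kappa>) = m" for \<kappa>
      using e[of \<kappa>] P_loc by blast
    \<comment> \<open>The index \<open>\<not> m\<close> keeps \<open>d\<close> apart from both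
      \<open>e \<kappa>\<close>. Conjunct \<open>i\<close> survives through \<open>A i k\<close>,
      since \<open>a\<close> is in neither set, so conjunct \<open>\<not> i\<close> is
      refuted.\<close>
    obtain d where d: "d \<in> T (\<not> j) (\<not> m)" "ai d = (\<not> i)"
    proof -
      obtain i0 where i0: "\<And>k0. \<not> A i0 k0 (- (T j (\<not> l) \<union> T (\<not> j) (\<not> m)))"
        using T_union[of j "\<not> l" "\<not> m"] by blast
      have "i0 \<noteq> i"
      proof
        assume e: "i0 = i"
        show False using A_meet[OF P_true[of i k] i0[of k, unfolded e]] Pa
          aT[of j "\<not> l"] aT[of "\<not> j" "\<not> m"] by auto
      qed
      then have i0': "i0 = (\<not> i)" by simp
      obtain k0 where "A (\<not> i) k0 (- T j (\<not> l))" using T_neg by blast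
      from T_extra[OF i0[of k0, unfolded i0'] this] that show ?thesis by blast
    qed
    have d_loc: "d \<in> V \<and> bj d = (\<not> j) \<and> bl d = (\<not> m)" using d T_loc by blast
    let ?xs = "[a, b True, b False, c True, c False, e True, e False, d]"
    have "distinct ?xs" using a b_loc c_loc e_loc d_loc d(2) neq by simp
    moreover have "set ?xs \<subseteq> V" using a b_loc c_loc e_loc d_loc by simp
    ultimately show False using no_eight[of ?xs] by simp
  next
    case other
    have Tt': "T (\<not> j) l' = {t}" using Tt other by simp
    \<comment> \<open>\<open>T j \<mu>\<close> refutes no conjunct, so the refuted one is the
      conjunct in which \<open>t\<close> occurs.\<close>
    have G: "\<not> A (ai t) k0 (- (T j \<mu> \<union> {t}))" for k0 \<mu>
    proof -
      obtain i0 where i0: "\<And>k0. \<not> A i0 k0 (- (T j \<mu> \<union> {t}))"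
        using T_union[of j \<mu> l'] Tt' by auto
      obtain k1 where k1: "A i0 k1 (- T j \<mu>)" using T_neg by blast
      have "i0 = ai t"
      proof (rule ccontr)
        assume ne: "i0 \<noteq> ai t"
        have "A i0 k1 (- (T j \<mu> \<union> {t}))" by (rule A_mono[OF k1]) (use ne in auto)
        then show False using i0 by blast
      qed
      then show ?thesis using i0 by simp
    qed
    have at: "a \<noteq> t" using a t other by auto
    have "ai t \<noteq> i"
    proof
      assume "ai t = i"
      then have "a \<in> T j (\<not> l) \<union> {t}" using A_meet[OF P_true[of i k], of "T j (\<not> l) \<union> {t}"] G[of k "\<not> l"] Pa by auto
      then show False using at aT[of j "\<not> l"] by auto
    qed
    then have ti: "ai t = (\<not> i)" by simp
    define \<kappa> where "\<kappa> = ak t"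
    have G2: "\<not> A (\<not> i) (\<not> \<kappa>) (- T j \<mu>)" for \<mu>
    proof
      assume "A (\<not> i) (\<not> \<kappa>) (- T j \<mu>)"
      then have "A (\<not> i) (\<not> \<kappa>) (- (T j \<mu> \<union> {t}))" by (rule A_mono) (auto simp: \<kappa>_def)
      then show False using G ti by simp
    qed
    obtain g where g: "g \<in> P (\<not> i) (\<not> \<kappa>)" "g \<in> T j l" using A_meet[OF P_true G2[of l]] by blast
    have g_loc: "g \<in> V \<and> ai g = (\<not> i) \<and> ak g = (\<not> \<kappa>) \<and> bj g = j \<and> bl g = l"
      using g P_loc T_loc by blast
    obtain h where h: "h \<in> T (\<not> j) (\<not> l')" "ai h = (\<not> i)" "ak h = \<kappa>"
    proof -
      obtain i0 where i0: "\<And>k0. \<not> A i0 k0 (- (T j (\<not> l) \<union> T (\<not> j) (\<not> l')))"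
        using T_union[of j "\<not> l" "\<not> l'"] by blast
      have "i0 \<noteq> i"
      proof
        assume e: "i0 = i"
        show False using A_meet[OF P_true[of i k] i0[of k, unfolded e]] Pa
          aT[of j "\<not> l"] aT[of "\<not> j" "\<not> l'"] by auto
      qed
      then have i0': "i0 = (\<not> i)" by simp
      obtain k0 where k0: "A (\<not> i) k0 (- T j (\<not> l))" using T_neg by blast
      have "k0 \<noteq> (\<not> \<kappa>)"
      proof
        assume e: "k0 = (\<not> \<kappa>)"
        show False using k0[unfolded e] G2 by blast
      qed
      then have "k0 = \<kappa>" by simp
      then have "A (\<not> i) \<kappa> (- T j (\<not> l))" using k0 by simp
      from T_extra[OF i0[of \<kappa>, unfolded i0'] this] that show ?thesis by blast
    qed
    have h_loc: "h \<in> V \<and> bj h = (\<not> j) \<and> bl h = (\<not> l')" using h T_loc by blast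
    \<comment> \<open>Both sets avoid \<open>t\<close>, and missing \<open>t\<close> refutes
      disjunct \<open>\<not> j\<close>; so disjunct \<open>j\<close> is satisfied. By F3,
      \<open>P (\<not> i) (\<not> \<kappa>)\<close> fails in conjunct \<open>l\<close>, which leaves
      the contribution to \<open>P i (\<not> k)\<close>.\<close>
    obtain p where p: "p \<in> P i (\<not> k)" "bj p = j" "bl p = l"
    proof -
      obtain j0 where j0: "\<And>l. B j0 l (P (\<not> i) (\<not> \<kappa>) \<union> P i (\<not> k))"
        using P_union[of "\<not> i" "\<not> \<kappa>" "\<not> k"] by auto
      have nin: "t \<notin> P (\<not> i) (\<not> \<kappa>) \<union> P i (\<not> k)" using P_loc[of t i "\<not> k"] P_loc[of t "\<not> i" "\<not> \<kappa>"] ti \<kappa>_def by auto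
      have "j0 \<noteq> (\<not> j)"
      proof
        assume e: "j0 = (\<not> j)"
        show False using B_meet[OF j0[of l', unfolded e] T_false] Tt' nin by auto
      qed
      then have "j0 = j" by simp
      then show ?thesis using P_extra[OF j0[of l, unfolded \<open>j0 = j\<close>] F3] that by blast
    qed
    have p_loc: "p \<in> V \<and> ai p = i \<and> ak p = (\<not> k)" using p P_loc by blast
    let ?xs = "\<lambda>p q. [a, p, q, b \<kappa>, b (\<not> \<kappa>), g, t, h]"
    note locs = a b_loc g_loc h_loc h(2,3) t other ti \<kappa>_def[symmetric] p_loc p(2,3)
    \<comment> \<open>The variables \<open>a\<close>, \<open>p\<close>, \<open>b \<kappa>\<close>,
      \<open>b (\<not> \<kappa>)\<close>, \<open>g\<close>, \<open>t\<close>, \<open>h\<close> are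
      seven; any \<open>q\<close> in one of these three positions would be an eighth.\<close>
    have eighth: False
      if q: "q \<in> V" "(ai q = (\<not> i) \<and> ak q = \<kappa> \<and> bj q = j \<and> bl q = l) \<or>
          (ai q = i \<and> ak q = (\<not> k) \<and> bj q = (\<not> j)) \<or> (ai q = i \<and> ak q = k \<and> q \<noteq> a)" for q
    proof -
      have "distinct (?xs p q)" using q(2)
      proof (elim disjE)
        assume "ai q = (\<not> i) \<and> ak q = \<kappa> \<and> bj q = j \<and> bl q = l"
        then show ?thesis using locs neq by simp
      next
        assume "ai q = i \<and> ak q = (\<not> k) \<and> bj q = (\<not> j)"
        then show ?thesis using locs neq by simp
      next
        assume "ai q = i \<and> ak q = k \<and> q \<noteq> a"
        then show ?thesis using locs neq by simp
      qed
      moreover have "set (?xs p q) \<subseteq> V" using locs q by simp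
      ultimately show False using no_eight[of "?xs p q"] by simp
    qed
    obtain j0 where j0: "\<And>l. B j0 l (P i (\<not> k) \<union> P (\<not> i) \<kappa>)" using P_union[of i "\<not> k" \<kappa>] by blast
    show False
    proof (cases "j0 = j")
      case False
      then have j0': "j0 = (\<not> j)" by simp
      obtain m where m: "\<not> B (\<not> j) m (P (\<not> i) \<kappa>)" using P_neg by blast
      have "B (\<not> j) m (P (\<not> i) \<kappa> \<union> P i (\<not> k))" using j0[of m] j0' by (simp add: Un_commute)
      then obtain q where "q \<in> P i (\<not> k)" "bj q = (\<not> j)" by (rule P_extra[OF _ m])
      then show False using eighth[of q] P_loc[of q i "\<not> k"] by blast
    next
      case True
      obtain r where r: "r \<in> P i (\<not> k) \<union> P (\<not> i) \<kappa>" "r \<in> T j l"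
        using B_meet[OF j0[of l, unfolded True] T_false] by blast
      have "r \<notin> P (\<not> i) \<kappa>" using eighth[of r] P_loc[of r "\<not> i" \<kappa>] T_loc[OF r(2)] by blast
      then have r': "r \<in> P i (\<not> k)" using r by blast
      have r_loc: "r \<in> V \<and> ai r = i \<and> ak r = (\<not> k) \<and> bj r = j \<and> bl r = l"
        using P_loc[OF r'] T_loc[OF r(2)] by blast
      obtain s where s: "s \<in> P i k \<union> P (\<not> i) \<kappa>" "s \<in> T j l"
        using B_meet[OF F1[of l \<kappa>] T_false] by blast
      have "s \<notin> P (\<not> i) \<kappa>" using eighth[of s] P_loc[of s "\<not> i" \<kappa>] T_loc[OF s(2)] by blast
      then have aTl: "a \<in> T j l" using s Pa by auto
      \<comment> \<open>Both \<open>a\<close> and \<open>r\<close> lie in \<open>T j l\<close>, but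
        some disjunct of conjunct \<open>i\<close> survives its removal, so the block of that
        disjunct contains a variable \<open>y\<close> different from both. In the second case below,
        \<open>r\<close> takes the place of \<open>p\<close> and \<open>y\<close> is the eighth
        variable.\<close>
      obtain k0 where k0: "A i k0 (- T j l)" using T_neg by blast
      then obtain y where y: "y \<in> V" "ai y = i" "ak y = k0" "y \<notin> T j l"
        using A_mono[of i k0 "- T j l" "{}"] A_empty[of i k0] by blast
      show False
      proof (cases "k0 = k")
        case True
        then show False using eighth[of y] y aTl by blast
      next
        case False
        then have "ak y = (\<not> k)" using y by simp
        moreover have "y \<noteq> r" using y r by blast
        ultimately have "distinct (?xs r y)" using locs r_loc y neq by simp
        moreover have "set (?xs r y) \<subseteq> V" using locs r_loc y by simp
        ultimately show False using no_eight[of "?xs r y"] by simp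
      qed
    qed
  qed
qed

end

subsection \<open>Three conjuncts\<close>

lemma bool_exhaust_neg: "P k \<Longrightarrow> P (\<not> k) \<Longrightarrow> P q"
  by (cases k; cases q) simp_all

text \<open>
  With at most seven variables, three conjuncts that are disjunctions have the form
  \<open>(x \<or> y) \<and> (z \<or> w) \<and> (u \<or> a)\<close>. Choose a \<open>T j l\<close> for every \<open>j\<close>: the union falsifies the premise. Each of
  \<open>{x, y}\<close> and \<open>{z, w}\<close> lies in at most a quarter of these unions and \<open>u\<close> in at most half of them,
  so all three bounds are attained and the unions are partitioned, which determines the conclusion almost completely.
\<close>

locale three_conjuncts =
  fixes x y z w u :: nat and a :: "nat set \<Rightarrow> bool" and Va V :: "nat set"
  assumes finV: "finite V" and card_V: "card V < 8"
    and V_eq: "V = {x, y, z, w, u} \<union> Va"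
    and dist: "distinct [x, y, z, w, u]" "Va \<inter> {x, y, z, w, u} = {}"
    and a_mono: "a X \<Longrightarrow> X \<inter> Va \<subseteq> Y \<Longrightarrow> a Y"
begin

text \<open>Failure of \<open>(x \<or> y) \<and> (z \<or> w) \<and> (u \<or> a)\<close> when the
  variables of \<open>F\<close> are the false ones.\<close>

definition falsifies :: "nat set \<Rightarrow> bool" where
  "falsifies F \<longleftrightarrow> (x \<in> F \<and> y \<in> F) \<or> (z \<in> F \<and> w \<in> F) \<or> (u \<in> F \<and> \<not> a (- F))"

text \<open>Five of at most seven variables lie outside \<open>a\<close>.\<close>

lemma Va_pair:
  assumes "v \<in> Va" "r \<in> Va" "v \<noteq> r" shows "Va = {v, r}"
proof -
  have fin: "finite Va" using finV V_eq by simp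
  have "card V = 5 + card Va"
    using dist fin by (subst V_eq, subst card_Un_disjoint) auto
  then have "card Va \<le> card {v, r}" using card_V assms by simp
  then show ?thesis using card_subset_eq[OF fin, of "{v, r}"] card_mono[OF fin, of "{v, r}"] assms by auto
qed

end

section \<open>Three conjuncts against two disjuncts\<close>

locale three_by_two = three_conjuncts +
  fixes B :: "bool \<Rightarrow> bool \<Rightarrow> nat set \<Rightarrow> bool" and bj bl :: "nat \<Rightarrow> bool"
    and T :: "bool \<Rightarrow> bool \<Rightarrow> nat set"
  assumes B_mono: "B j l X \<Longrightarrow> (\<And>x. x \<in> X \<Longrightarrow> x \<in> V \<Longrightarrow> bj x = j \<Longrightarrow> bl x = l \<Longrightarrow> x \<in> Y) \<Longrightarrow> B j l Y"
    and imp: "(\<And>j. \<exists>l. \<not> B j l (- F)) \<Longrightarrow> falsifies F"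
    and T_loc: "t \<in> T j l \<Longrightarrow> t \<in> V \<and> bj t = j \<and> bl t = l"
    and T_false: "\<not> B j l (- T j l)" and T_neg: "\<not> falsifies (T j l)"
begin

lemma both_sides:
  assumes "\<not> B j l Y" "\<not> B (\<not> j) l' Y" shows "\<exists>l. \<not> B j0 l Y"
proof -
  have "j0 = j \<or> j0 = (\<not> j)" by blast
  then show ?thesis
  proof
    assume "j0 = j"
    with assms(1) show ?thesis by blast
  next
    assume "j0 = (\<not> j)"
    with assms(2) show ?thesis by blast
  qed
qed

lemma T_union: "falsifies (T j l \<union> T (\<not> j) l')"
proof (rule imp)
  fix j0
  have "\<not> B j l (- (T j l \<union> T (\<not> j) l'))" "\<not> B (\<not> j) l' (- (T j l \<union> T (\<not> j) l'))"
    using B_mono[of j l "- (T j l \<union> T (\<not> j) l')" "- T j l"] T_false[of j l]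
      B_mono[of "\<not> j" l' "- (T j l \<union> T (\<not> j) l')" "- T (\<not> j) l'"] T_false[of "\<not> j" l'] by blast+
  then show "\<exists>l0. \<not> B j0 l0 (- (T j l \<union> T (\<not> j) l'))" by (rule both_sides)
qed

text \<open>The unions of \<open>T j l\<close> with \<open>T (\<not> j) q\<close> miss
  \<open>x'\<close> and \<open>z'\<close>, so they must refute \<open>u \<or> a\<close>. This forces
  \<open>a\<close> to consist of two variables, both needed for its truth, and \<open>X\<close> then
  satisfies disjunct \<open>\<not> j\<close>.\<close>

lemma a_implies:
  assumes aX: "a X" and X: "{x', y'} = {x, y}" "{z', w'} = {z, w}"
    and m: "x' \<in> T j (\<not> l)" "z' \<in> T j (\<not> l)" "y' \<in> T (\<not> j) k" "w' \<in> T (\<not> j) (\<not> k)"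
    and u: "bj u = j" "bl u = l"
  shows "\<exists>j. \<forall>l. B j l X"
proof -
  have mem: "(x \<in> F \<and> y \<in> F) = (x' \<in> F \<and> y' \<in> F)" "(z \<in> F \<and> w \<in> F) = (z' \<in> F \<and> w' \<in> F)" for F
    using X by (auto simp: doubleton_eq_iff)
  have fals: "falsifies F \<longleftrightarrow> (x' \<in> F \<and> y' \<in> F) \<or> (z' \<in> F \<and> w' \<in> F) \<or> (u \<in> F \<and> \<not> a (- F))" for F
    unfolding falsifies_def mem ..
  have V': "V = {x', y', z', w', u} \<union> Va" and d: "distinct [x', y', z', w', u]" "Va \<inter> {x', y', z', w', u} = {}"
    using V_eq dist X by (auto simp: doubleton_eq_iff)
  note loc = m[THEN T_loc]
  have nin: "x' \<notin> T j l" "z' \<notin> T j l" "x' \<notin> T (\<not> j) q" "z' \<notin> T (\<not> j) q" "u \<notin> T (\<not> j) q" for q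
    using loc u T_loc by blast+
  have uT: "u \<in> T j l" and cov: "\<not> a (- (T j l \<union> T (\<not> j) q))" for q
    using T_union[of j l q] nin unfolding fals by blast+
  have aT: "a (- T j l)" using T_neg[of j l] uT unfolding fals by blast
  have "\<exists>v. v \<in> Va \<and> v \<in> T (\<not> j) q" for q
    using a_mono[OF aT, of "- (T j l \<union> T (\<not> j) q)"] cov[of q] by blast
  then obtain v where v: "\<And>q. v q \<in> Va \<and> v q \<in> T (\<not> j) q" by metis
  have v_loc: "v q \<in> V \<and> bj (v q) = (\<not> j) \<and> bl (v q) = q" for q using v T_loc by blast
  have "v k \<noteq> v (\<not> k)" using v_loc[of k] v_loc[of "\<not> k"] by metis
  then have Va: "Va = {v k, v (\<not> k)}" using Va_pair v by blast
  have Va': "Va = {v q, v (\<not> q)}" for q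
  proof (cases "q = k")
    case False
    then have "q = (\<not> k)" by simp
    then show ?thesis using Va by (simp add: insert_commute)
  qed (use Va in simp)
  \<comment> \<open>If \<open>v q\<close> were missing, the rest of \<open>X\<close> in
    \<open>Va\<close> would avoid \<open>T j l \<union> T (\<not> j) q\<close>, although making this
    union false refutes \<open>a\<close>.\<close>
  have vX: "v q \<in> X" for q
  proof (rule ccontr)
    assume n: "v q \<notin> X"
    have "X \<inter> Va \<subseteq> {v (\<not> q)}" unfolding Va'[of q] using n by blast
    moreover have "v (\<not> q) \<notin> T j l \<union> T (\<not> j) q" using v_loc[of "\<not> q"] T_loc[of "v (\<not> q)" j l] T_loc[of "v (\<not> q)" "\<not> j" q] by auto
    ultimately have "X \<inter> Va \<subseteq> - (T j l \<union> T (\<not> j) q)" by blast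
    from a_mono[OF aX this] cov show False by blast
  qed
  \<comment> \<open>The block \<open>(\<not> j, q)\<close> consists of \<open>e\<close> and
    \<open>v q\<close>. If \<open>v q\<close> did not suffice for it, making
    \<open>T j l \<union> {e}\<close> false would refute the conclusion, yet it leaves
    \<open>x'\<close>, \<open>z'\<close> and \<open>a\<close> true.\<close>
  have B: "B (\<not> j) q X" if e: "e \<in> T (\<not> j) q" "e = y' \<or> e = w'"
    and o: "\<And>t. t \<in> V \<Longrightarrow> bj t = (\<not> j) \<Longrightarrow> bl t = q \<Longrightarrow> t = e \<or> t = v q" for e q
  proof (rule ccontr)
    assume n: "\<not> B (\<not> j) q X"
    let ?F = "T j l \<union> {e}"
    have "\<not> B j l (- ?F)" using B_mono[of j l "- ?F" "- T j l"] T_false[of j l] by blast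
    moreover have "\<not> B (\<not> j) q (- ?F)"
    proof
      assume "B (\<not> j) q (- ?F)"
      then have "B (\<not> j) q X"
      proof (rule B_mono)
        fix t assume "t \<in> - ?F" "t \<in> V" "bj t = (\<not> j)" "bl t = q"
        then have "t = v q" using o[of t] by blast
        then show "t \<in> X" using vX by simp
      qed
      with n show False by blast
    qed
    ultimately have "falsifies ?F" by (intro imp both_sides)
    moreover have "x' \<notin> ?F" "z' \<notin> ?F" using nin e(2) d by auto
    moreover have "a (- ?F)"
      by (rule a_mono[OF aT]) (use Va v d(2) e(2) in auto)
    ultimately show False unfolding fals by blast
  qed
  have V7: "t \<in> {x', y', z', w', u, v k, v (\<not> k)}" if "t \<in> V" for t using V' Va that by blast
  have "B (\<not> j) k X"
  proof (rule B[OF m(3)])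
    fix t assume t: "t \<in> V" "bj t = (\<not> j)" "bl t = k"
    have "t \<noteq> x'" "t \<noteq> z'" "t \<noteq> w'" "t \<noteq> u" "t \<noteq> v (\<not> k)"
      using t loc u v_loc[of "\<not> k"] by auto
    then show "t = y' \<or> t = v k" using V7[OF t(1)] by blast
  qed simp
  moreover have "B (\<not> j) (\<not> k) X"
  proof (rule B[OF m(4)])
    fix t assume t: "t \<in> V" "bj t = (\<not> j)" "bl t = (\<not> k)"
    have "t \<noteq> x'" "t \<noteq> z'" "t \<noteq> y'" "t \<noteq> u" "t \<noteq> v k"
      using t loc u v_loc[of k] by auto
    then show "t = w' \<or> t = v (\<not> k)" using V7[OF t(1)] by blast
  qed simp
  ultimately have "B (\<not> j) q X" for q by (rule bool_exhaust_neg)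
  then show ?thesis by blast
qed

lemma a_implies_some:
  assumes "a X" shows "\<exists>j. \<forall>l. B j l X"
proof -
  define j l where "j = bj u" and "l = bl u"
  have c: "(x \<in> T j (\<not> l) \<union> T (\<not> j) q \<and> y \<in> T j (\<not> l) \<union> T (\<not> j) q) \<or>
      (z \<in> T j (\<not> l) \<union> T (\<not> j) q \<and> w \<in> T j (\<not> l) \<union> T (\<not> j) q)" for q
  proof -
    have "u \<notin> T j (\<not> l) \<union> T (\<not> j) q" using T_loc[of u j "\<not> l"] T_loc[of u "\<not> j" q] j_def l_def by auto
    then show ?thesis using T_union[of j "\<not> l" q] unfolding falsifies_def by blast
  qed
  have ex: "\<not> (t \<in> T (\<not> j) True \<and> t \<in> T (\<not> j) False)"
    "\<not> (t \<in> T (\<not> j) q \<and> t \<in> T j (\<not> l))" for t q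
    using T_loc[of t "\<not> j" True] T_loc[of t "\<not> j" False] T_loc[of t "\<not> j" q] T_loc[of t j "\<not> l"] by auto
  have n: "\<not> (x \<in> T j' l' \<and> y \<in> T j' l')" "\<not> (z \<in> T j' l' \<and> w \<in> T j' l')" for j' l'
    using T_neg[of j' l'] unfolding falsifies_def by blast+
  let ?Q = "\<lambda>x y z w. x \<in> T j (\<not> l) \<and> z \<in> T j (\<not> l) \<and>
    ((y \<in> T (\<not> j) True \<and> w \<in> T (\<not> j) False) \<or> (y \<in> T (\<not> j) False \<and> w \<in> T (\<not> j) True))"
  have Q: ?thesis if s: "{x', y'} = {x, y}" "{z', w'} = {z, w}" and q: "?Q x' y' z' w'" for x' y' z' w'
  proof -
    have m: "x' \<in> T j (\<not> l)" "z' \<in> T j (\<not> l)" using q by blast+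
    have "y' \<in> T (\<not> j) True \<and> w' \<in> T (\<not> j) (\<not> True) \<or> y' \<in> T (\<not> j) False \<and> w' \<in> T (\<not> j) (\<not> False)"
      using q by simp
    then show ?thesis
      using a_implies[OF assms s m _ _ j_def[symmetric] l_def[symmetric]] by blast
  qed
  \<comment> \<open>No pair lies in a single \<open>T\<close>, and one pair cannot serve both values
    of \<open>q\<close>. So each pair serves one value, with one element in
    \<open>T j (\<not> l)\<close> and the other in \<open>T (\<not> j) q\<close>.\<close>
  have "?Q x y z w \<or> ?Q y x z w \<or> ?Q x y w z \<or> ?Q y x w z"
    using c[of True] c[of False] n[of j "\<not> l"] n[of "\<not> j" True] n[of "\<not> j" False]
      ex(1)[of x] ex(1)[of y] ex(1)[of z] ex(1)[of w] ex(2)[of x True] ex(2)[of x False] ex(2)[of y True] ex(2)[of y False]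
      ex(2)[of z True] ex(2)[of z False] ex(2)[of w True] ex(2)[of w False]
    unfolding Un_iff by satx
  then show ?thesis
  proof (elim disjE)
    assume "?Q x y z w"
    then show ?thesis by (rule Q[OF refl refl])
  next
    assume "?Q y x z w"
    then show ?thesis by (rule Q[OF insert_commute refl])
  next
    assume "?Q x y w z"
    then show ?thesis by (rule Q[OF refl insert_commute])
  next
    assume "?Q y x w z"
    then show ?thesis by (rule Q[OF insert_commute insert_commute])
  qed
qed

end

section \<open>Three conjuncts against three disjuncts\<close>

locale three_by_three = three_conjuncts +
  fixes B :: "'j \<Rightarrow> bool \<Rightarrow> nat set \<Rightarrow> bool" and bj :: "nat \<Rightarrow> 'j" and bl :: "nat \<Rightarrow> bool"
    and T :: "'j \<Rightarrow> bool \<Rightarrow> nat set"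
  assumes three: "\<exists>j' j''. j \<noteq> j' \<and> j \<noteq> j'' \<and> j' \<noteq> j'' \<and> (\<forall>k. k = j \<or> k = j' \<or> k = j'')"
    and B_mono: "B j l X \<Longrightarrow> (\<And>x. x \<in> X \<Longrightarrow> x \<in> V \<Longrightarrow> bj x = j \<Longrightarrow> bl x = l \<Longrightarrow> x \<in> Y) \<Longrightarrow> B j l Y"
    and B_UNIV: "B j l UNIV"
    and imp: "(\<And>j. \<exists>l. \<not> B j l (- F)) \<Longrightarrow> falsifies F"
    and T_loc: "t \<in> T j l \<Longrightarrow> t \<in> V \<and> bj t = j \<and> bl t = l"
    and T_false: "\<not> B j l (- T j l)" and T_neg: "\<not> falsifies (T j l)"
begin

lemma T_union:
  assumes "\<And>k. k = j \<or> k = j' \<or> k = j''"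
  shows "falsifies (T j l \<union> T j' p \<union> T j'' q)"
proof (rule imp)
  fix j0
  have *: "\<not> B j0 l0 (- (T j l \<union> T j' p \<union> T j'' q))"
    if "T j0 l0 \<subseteq> T j l \<union> T j' p \<union> T j'' q" for j0 l0
    using B_mono[of j0 l0 "- (T j l \<union> T j' p \<union> T j'' q)" "- T j0 l0"] T_false[of j0 l0] that by blast
  show "\<exists>l0. \<not> B j0 l0 (- (T j l \<union> T j' p \<union> T j'' q))"
    using assms[of j0] *[of j l] *[of j' p] *[of j'' q] by blast
qed

text \<open>The five variables outside \<open>a\<close> lie in the blocks of \<open>j\<close> and
  \<open>j1\<close>, so disjunct \<open>j2\<close> contains just the two variables of
  \<open>a\<close>, one per conjunct. As in the case of two disjuncts, \<open>a\<close> needs both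
  of them.\<close>

lemma a_implies:
  assumes aX: "a X" and X: "{x', y'} = {x, y}" "{z', w'} = {z, w}"
    and js: "j \<noteq> j1" "j \<noteq> j2" "j1 \<noteq> j2" "\<And>k. k = j \<or> k = j1 \<or> k = j2"
    and m: "x' \<in> T j (\<not> l)" "z' \<in> T j (\<not> l)" "y' \<in> T j1 k" "w' \<in> T j1 (\<not> k)"
    and u: "bj u = j" "bl u = l"
  shows "\<exists>j. \<forall>l. B j l X"
proof -
  have mem: "(x \<in> F \<and> y \<in> F) = (x' \<in> F \<and> y' \<in> F)" "(z \<in> F \<and> w \<in> F) = (z' \<in> F \<and> w' \<in> F)" for F
    using X by (auto simp: doubleton_eq_iff)
  have fals: "falsifies F \<longleftrightarrow> (x' \<in> F \<and> y' \<in> F) \<or> (z' \<in> F \<and> w' \<in> F) \<or> (u \<in> F \<and> \<not> a (- F))" for F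
    unfolding falsifies_def mem ..
  have V': "V = {x', y', z', w', u} \<union> Va" and d: "distinct [x', y', z', w', u]" "Va \<inter> {x', y', z', w', u} = {}"
    using V_eq dist X by (auto simp: doubleton_eq_iff)
  note loc = m[THEN T_loc]
  let ?T = "\<lambda>p q. T j l \<union> T j1 p \<union> T j2 q"
  have nin: "x' \<notin> ?T p q" "z' \<notin> ?T p q" "u \<notin> T j1 p" "u \<notin> T j2 q" for p q
    using loc u js(1,2) T_loc[of x' j l] T_loc[of x' j1 p] T_loc[of x' j2 q]
      T_loc[of z' j l] T_loc[of z' j1 p] T_loc[of z' j2 q] T_loc[of u j1 p] T_loc[of u j2 q] by auto
  have uT: "u \<in> T j l" and cov: "\<not> a (- ?T p q)" for p q
    using T_union[OF js(4), of l p q] nin unfolding fals by blast+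
  have aT: "a (- T j l)" using T_neg[of j l] uT unfolding fals by blast
  have "T j2 q \<noteq> {}" for q using T_false[of j2 q] B_UNIV[of j2 q] by auto
  then obtain v where v: "\<And>q. v q \<in> T j2 q" by (meson ex_in_conv)
  have v_loc: "v q \<in> V \<and> bj (v q) = j2 \<and> bl (v q) = q" for q using v T_loc by blast
  have "bj (v q) \<noteq> bj x'" "bj (v q) \<noteq> bj y'" "bj (v q) \<noteq> bj z'" "bj (v q) \<noteq> bj w'" "bj (v q) \<noteq> bj u" for q
    using v_loc[of q] loc u js(1,2,3) by simp_all
  then have "v q \<noteq> x'" "v q \<noteq> y'" "v q \<noteq> z'" "v q \<noteq> w'" "v q \<noteq> u" for q by metis+
  then have vVa: "v q \<in> Va" for q using v_loc[of q] unfolding V' by simp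
  have "v True \<noteq> v False" using v_loc[of True] v_loc[of False] by metis
  then have Va: "Va = {v True, v False}" by (rule Va_pair[OF vVa vVa])
  have Va': "Va = {v q, v (\<not> q)}" for q unfolding Va by (cases q) (simp_all add: insert_commute)
  have V7: "t \<in> {x', y', z', w', u, v q, v (\<not> q)}" if "t \<in> V" for t q using that unfolding V' Va'[of q] Un_iff insert_iff by satx
  have vX: "v q \<in> X" for q
  proof (rule ccontr)
    assume n: "v q \<notin> X"
    have "X \<inter> Va \<subseteq> {v (\<not> q)}" unfolding Va'[of q] using n by blast
    moreover have "v (\<not> q) \<notin> ?T k q"
    proof -
      note vq = v_loc[of "\<not> q", THEN conjunct2]
      have "v (\<not> q) \<notin> T j l"
      proof
        assume "v (\<not> q) \<in> T j l"
        then have "bj (v (\<not> q)) = j" using T_loc by blast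
        then show False using vq js(2) by simp
      qed
      moreover have "v (\<not> q) \<notin> T j1 k"
      proof
        assume "v (\<not> q) \<in> T j1 k"
        then have "bj (v (\<not> q)) = j1" using T_loc by blast
        then show False using vq js(3) by simp
      qed
      moreover have "v (\<not> q) \<notin> T j2 q"
      proof
        assume "v (\<not> q) \<in> T j2 q"
        then have "bl (v (\<not> q)) = q" using T_loc by blast
        then show False using vq by simp
      qed
      ultimately show ?thesis by simp
    qed
    ultimately have "X \<inter> Va \<subseteq> - ?T k q" by blast
    from a_mono[OF aX this] cov show False by blast
  qed
  have "B j2 q X" for q
  proof (rule B_mono[OF B_UNIV])
    fix t assume t: "t \<in> V" "bj t = j2" "bl t = q"
    have "bj t \<noteq> bj x'" "bj t \<noteq> bj z'" "bj t \<noteq> bj y'" "bj t \<noteq> bj w'" "bj t \<noteq> bj u"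
      using t loc u js(2,3) by simp_all
    then have "t \<noteq> x'" "t \<noteq> z'" "t \<noteq> y'" "t \<noteq> w'" "t \<noteq> u" by metis+
    moreover have "t \<noteq> v (\<not> q)" using t v_loc[of "\<not> q"] by metis
    ultimately have "t = v q" using V7[OF t(1), of q] by blast
    then show "t \<in> X" using vX by simp
  qed
  then show ?thesis by blast
qed

lemma a_implies_some:
  assumes "a X" shows "\<exists>j. \<forall>l. B j l X"
proof -
  define j l where "j = bj u" and "l = bl u"
  obtain j' j'' where js: "j \<noteq> j'" "j \<noteq> j''" "j' \<noteq> j''" "\<And>k. k = j \<or> k = j' \<or> k = j''"
    using three by metis
  have c: "(x \<in> T j (\<not> l) \<union> T j' p \<union> T j'' q \<and> y \<in> T j (\<not> l) \<union> T j' p \<union> T j'' q) \<or>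
      (z \<in> T j (\<not> l) \<union> T j' p \<union> T j'' q \<and> w \<in> T j (\<not> l) \<union> T j' p \<union> T j'' q)" for p q
  proof -
    have "u \<notin> T j (\<not> l) \<union> T j' p \<union> T j'' q"
      using T_loc[of u j "\<not> l"] T_loc[of u j' p] T_loc[of u j'' q] js(1,2) j_def l_def by auto
    then show ?thesis using T_union[OF js(4), of "\<not> l" p q] unfolding falsifies_def by blast
  qed
  have ex: "\<not> (t \<in> T j' True \<and> t \<in> T j' False)" "\<not> (t \<in> T j'' True \<and> t \<in> T j'' False)" for t
    using T_loc[of t j' True] T_loc[of t j' False] T_loc[of t j'' True] T_loc[of t j'' False] by auto
  have ex2: "\<not> (t \<in> T j' q \<and> t \<in> T j (\<not> l))" "\<not> (t \<in> T j'' q \<and> t \<in> T j (\<not> l))" "\<not> (t \<in> T j' q \<and> t \<in> T j'' p)" for t p q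
    using T_loc[of t j' q] T_loc[of t j'' q] T_loc[of t j'' p] T_loc[of t j "\<not> l"] js(1,2,3) by auto
  have n: "\<not> (x \<in> T j' l' \<and> y \<in> T j' l')" "\<not> (z \<in> T j' l' \<and> w \<in> T j' l')" for j' l'
    using T_neg[of j' l'] unfolding falsifies_def by blast+
  let ?R = "\<lambda>j1 y w. (y \<in> T j1 True \<and> w \<in> T j1 False) \<or> (y \<in> T j1 False \<and> w \<in> T j1 True)"
  let ?Q = "\<lambda>x y z w. x \<in> T j (\<not> l) \<and> z \<in> T j (\<not> l) \<and> (?R j' y w \<or> ?R j'' y w)"
  have Q: ?thesis if s: "{x', y'} = {x, y}" "{z', w'} = {z, w}" and q: "?Q x' y' z' w'" for x' y' z' w'
  proof -
    have m: "x' \<in> T j (\<not> l)" "z' \<in> T j (\<not> l)" using q by blast+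
    have js': "k = j \<or> k = j'' \<or> k = j'" for k using js(4) by blast
    have R: "y' \<in> T j1 True \<and> w' \<in> T j1 (\<not> True) \<or> y' \<in> T j1 False \<and> w' \<in> T j1 (\<not> False)"
      if "?R j1 y' w'" for j1 using that by simp
    note A = a_implies[OF assms s _ _ _ _ m _ _ j_def[symmetric] l_def[symmetric]]
    from q have "?R j' y' w' \<or> ?R j'' y' w'" by blast
    then show ?thesis
    proof
      assume "?R j' y' w'"
      then show ?thesis using R[of j'] A[OF js] by blast
    next
      assume "?R j'' y' w'"
      then show ?thesis using R[of j''] A[OF js(2,1) js(3)[symmetric] js'] by blast
    qed
  qed
  \<comment> \<open>Of the four choices of \<open>p\<close> and \<open>q\<close>, a pair covers two
    if one element lies in \<open>T j (\<not> l)\<close>, otherwise at most one. The two pairs must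
    therefore cover complementary halves, which puts their other elements into the two sets of one
    and the same disjunct \<open>j'\<close> or \<open>j''\<close>.\<close>
  have "?Q x y z w \<or> ?Q y x z w \<or> ?Q x y w z \<or> ?Q y x w z"
    using c[of True True] c[of True False] c[of False True] c[of False False]
      n[of j "\<not> l"] n[of j' True] n[of j' False] n[of j'' True] n[of j'' False]
      ex[of x] ex[of y] ex[of z] ex[of w] 
      ex2(1,2)[of x True] ex2(1,2)[of x False] ex2(1,2)[of y True] ex2(1,2)[of y False]
      ex2(1,2)[of z True] ex2(1,2)[of z False] ex2(1,2)[of w True] ex2(1,2)[of w False]
      ex2(3)[of x True True] ex2(3)[of x True False] ex2(3)[of x False True] ex2(3)[of x False False]
      ex2(3)[of y True True] ex2(3)[of y True False] ex2(3)[of y False True] ex2(3)[of y False False]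
      ex2(3)[of z True True] ex2(3)[of z True False] ex2(3)[of z False True] ex2(3)[of z False False]
      ex2(3)[of w True True] ex2(3)[of w True False] ex2(3)[of w False True] ex2(3)[of w False False]
    unfolding Un_iff by satx
  then show ?thesis
  proof (elim disjE)
    assume "?Q x y z w"
    then show ?thesis by (rule Q[OF refl refl])
  next
    assume "?Q y x z w"
    then show ?thesis by (rule Q[OF insert_commute refl])
  next
    assume "?Q x y w z"
    then show ?thesis by (rule Q[OF refl insert_commute])
  next
    assume "?Q y x w z"
    then show ?thesis by (rule Q[OF insert_commute insert_commute])
  qed
qed

end

lemma ac_Or_dual: "ac (dual g) f \<Longrightarrow> ac g (dual f)"
  using ac_dual[of "dual g" f] by simp

subsection \<open>A conjunct that is a single variable\<close>

text \<open>\<open>h\<close> is \<open>g\<close> with \<open>x\<close> set to true, and it arises by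
  deleting the occurrence of \<open>x\<close> when \<open>x\<close> is a conjunct.\<close>

definition pull :: "nat \<Rightarrow> form \<Rightarrow> form \<Rightarrow> bool" where
  "pull x g h \<longleftrightarrow> positive h \<and> vars h = vars g - {x} \<and> (\<forall>v. v x \<longrightarrow> eval v h = eval v g) \<and>
     der (And (Var x) h) g"

lemma pull_ac:
  assumes "pull x g h" "ac g g'" shows "pull x g' h"
  using assms ac_vars[OF assms(2)] ac_eval[OF assms(2)] der_trans[OF _ der_ac[OF assms(2)]]
  unfolding pull_def by simp

lemma pull_And:
  assumes "positive (And a b)" "x \<in> vars a" "pull x a h"
  shows "pull x (And a b) (And h b)"
proof -
  have "der (And (Var x) (And h b)) (And (And (Var x) h) b)"
    by (rule der_ac, rule ac_sym, rule ac_and_assoc)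
  also have "der \<dots> (And a b)"
    using assms(3) unfolding pull_def by (intro der_and) simp_all
  finally show ?thesis using assms unfolding pull_def by auto
qed

lemma pull_And_Var:
  assumes "positive (And (Var x) b)"
  shows "pull x (And (Var x) b) b"
  using assms unfolding pull_def by auto

text \<open>The only place where pulling out a variable costs a switch.\<close>

lemma pull_Or:
  assumes "positive (Or a b)" "x \<in> vars a" "pull x a h"
  shows "pull x (Or a b) (Or h b)"
proof -
  have "der (And (Var x) (Or h b)) (Or (And (Var x) h) b)"
    by (rule der_step, rule step_switch)
  also have "der \<dots> (Or a b)"
    using assms(3) unfolding pull_def by (intro der_or) simp_all
  finally show ?thesis using assms unfolding pull_def by auto
qed

lemma positive_singleton: "positive f \<Longrightarrow> vars f = {x} \<Longrightarrow> f = Var x"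
proof (cases f)
  case (And a b)
  assume "positive f" "vars f = {x}"
  then show ?thesis using And vars_nonempty[of a] vars_nonempty[of b]
    by (simp, metis Int_Un_eq(1) Un_singleton_iff inf.idem insert_not_empty)
next
  case (Or a b)
  assume "positive f" "vars f = {x}"
  then show ?thesis using Or vars_nonempty[of a] vars_nonempty[of b]
    by (simp, metis Int_Un_eq(1) Un_singleton_iff inf.idem insert_not_empty)
qed auto

text \<open>Every other variable still decides \<open>g\<close> while \<open>x\<close> is true. This
  excludes a subformula in which \<open>x\<close> itself is a disjunct.\<close>

definition essential :: "nat \<Rightarrow> form \<Rightarrow> bool" where
  "essential x g \<longleftrightarrow>
     (\<forall>y \<in> vars g - {x}. \<exists>v. v x \<and> eval (v(y := True)) g \<and> \<not> eval (v(y := False)) g)"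

lemma essential_connective:
  assumes "positive a" "positive b" "vars a \<inter> vars b = {}" "f = And a b \<or> f = Or a b" "essential x f"
  shows "essential x a"
  unfolding essential_def
proof
  fix y assume y: "y \<in> vars a - {x}"
  then have "y \<in> vars f - {x}" using assms(4) by auto
  then obtain v where v: "v x" "eval (v(y := True)) f" "\<not> eval (v(y := False)) f"
    using assms(5) unfolding essential_def by blast
  have "eval (v(y := True)) b = eval (v(y := False)) b"
    using y assms(3) by (intro eval_cong_vars) auto
  then show "\<exists>v. v x \<and> eval (v(y := True)) a \<and> \<not> eval (v(y := False)) a"
    using v assms(4) by (intro exI[of _ v]) auto
qed

lemma essential_ac: "essential x f \<Longrightarrow> ac f g \<Longrightarrow> essential x g"
  unfolding essential_def using ac_eval[of f g] ac_vars[of f g] by simp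

text \<open>If \<open>f\<close> were a disjunction of \<open>x\<close> and \<open>b\<close>, then
  \<open>x\<close> alone would make it true and no variable of \<open>b\<close> could
  matter.\<close>

lemma pull_connective:
  assumes "positive f" "f = And a b \<or> f = Or a b" "x \<in> vars a" "essential x f"
    "essential x a \<Longrightarrow> vars a \<noteq> {x} \<Longrightarrow> \<exists>h. pull x a h"
  shows "\<exists>h. pull x f h"
proof (cases "vars a = {x}")
  case True
  then have a: "a = Var x" using positive_singleton assms(1,2) by auto
  from assms(2) show ?thesis
  proof
    assume "f = And a b"
    then show ?thesis using pull_And_Var a assms(1) by blast
  next
    assume f: "f = Or a b"
    then obtain y where "y \<in> vars b" "y \<noteq> x" using vars_nonempty[of b] assms(1) a by auto
    then obtain v where "v x" "\<not> eval (v(y := False)) f"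
      using assms(4) f unfolding essential_def by auto
    then show ?thesis using f a \<open>y \<noteq> x\<close> by simp
  qed
next
  case False
  have "essential x a" using essential_connective[of a b f x] assms(1,2,4) by auto
  then obtain h where "pull x a h" using assms(5) False by blast
  then show ?thesis using assms(1,2,3) pull_And pull_Or by blast
qed

lemma pull_exists:
  assumes "positive g" "x \<in> vars g" "vars g \<noteq> {x}" "essential x g"
  shows "\<exists>h. pull x g h"
  using assms
proof (induction g)
  case (And a b)
  have IHa: "essential x a \<Longrightarrow> vars a \<noteq> {x} \<Longrightarrow> \<exists>h. pull x a h" if "x \<in> vars a"
    using And.IH(1) And.prems(1) that by simp
  have IHb: "essential x b \<Longrightarrow> vars b \<noteq> {x} \<Longrightarrow> \<exists>h. pull x b h" if "x \<in> vars b"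
    using And.IH(2) And.prems(1) that by simp
  show ?case
  proof (cases "x \<in> vars a")
    case True
    then show ?thesis using pull_connective[OF And.prems(1) _ True And.prems(4)] IHa by blast
  next
    case False
    then have b: "x \<in> vars b" using And.prems(2) by simp
    have "positive (And b a)" "essential x (And b a)"
      using And.prems ac_and_comm ac_positive essential_ac by blast+
    then have "\<exists>h. pull x (And b a) h" using pull_connective[of "And b a" b a x] IHb b by blast
    then show ?thesis using pull_ac ac_and_comm by blast
  qed
next
  case (Or a b)
  have IHa: "essential x a \<Longrightarrow> vars a \<noteq> {x} \<Longrightarrow> \<exists>h. pull x a h" if "x \<in> vars a"
    using Or.IH(1) Or.prems(1) that by simp
  have IHb: "essential x b \<Longrightarrow> vars b \<noteq> {x} \<Longrightarrow> \<exists>h. pull x b h" if "x \<in> vars b"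
    using Or.IH(2) Or.prems(1) that by simp
  show ?case
  proof (cases "x \<in> vars a")
    case True
    then show ?thesis using pull_connective[OF Or.prems(1) _ True Or.prems(4)] IHa by blast
  next
    case False
    then have b: "x \<in> vars b" using Or.prems(2) by simp
    have "positive (Or b a)" "essential x (Or b a)"
      using Or.prems ac_or_comm ac_positive essential_ac by blast+
    then have "\<exists>h. pull x (Or b a) h" using pull_connective[of "Or b a" b a x] IHb b by blast
    then show ?thesis using pull_ac ac_or_comm by blast
  qed
qed auto

text \<open>For \<open>y\<close> in \<open>r\<close>, a witness must have \<open>x\<close> true
  because \<open>x\<close> is a conjunct of the premise. This makes \<open>x\<close> essential in
  \<open>g\<close> and carries the witness over to \<open>r\<close> and \<open>h\<close>.\<close>

lemma nontrivial_inf_And_Var: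
  assumes "nontrivial_inf (And (Var x) r) g"
  obtains h where "nontrivial_inf r h" "der (And (Var x) h) g"
proof -
  let ?f = "And (Var x) r"
  have pos: "positive r" "positive g" "x \<notin> vars r" "vars g = insert x (vars r)"
    and val: "\<And>v. v x \<Longrightarrow> eval v r \<Longrightarrow> eval v g"
    using assms by (auto simp: nontrivial_inf_def valid_inf_def)
  have wit: "\<exists>v. v x \<and> eval (v(y := True)) r \<and> \<not> eval (v(y := False)) g" if y: "y \<in> vars r" for y
  proof -
    have "y \<in> vars ?f" "y \<noteq> x" using y pos(3) by auto
    then obtain v where "eval (v(y := True)) ?f" "\<not> eval (v(y := False)) g"
      using assms unfolding nontrivial_inf_def by blast
    then show ?thesis using \<open>y \<noteq> x\<close> by (intro exI[of _ v]) simp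
  qed
  have "essential x g" unfolding essential_def
  proof
    fix y assume "y \<in> vars g - {x}"
    then have y: "y \<in> vars r" "y \<noteq> x" using pos(4) by auto
    then obtain v where v: "v x" "eval (v(y := True)) r" "\<not> eval (v(y := False)) g" using wit by blast
    then have "eval (v(y := True)) g" using val[of "v(y := True)"] y(2) by simp
    with v show "\<exists>v. v x \<and> eval (v(y := True)) g \<and> \<not> eval (v(y := False)) g" by blast
  qed
  moreover have "vars g \<noteq> {x}" using pos vars_nonempty[of r] by auto
  ultimately obtain h where h: "pull x g h" using pull_exists[of g x] pos by auto
  have vh: "vars h = vars r" "positive h" "der (And (Var x) h) g" "\<And>v. v x \<Longrightarrow> eval v h = eval v g"
    using h pos unfolding pull_def by auto
  have "nontrivial_inf r h" unfolding nontrivial_inf_def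
  proof (intro conjI ballI)
    show "valid_inf r h" unfolding valid_inf_def
    proof (intro allI impI)
      fix v assume "eval v r"
      then have "eval (v(x := True)) r" using pos(3) by (simp add: eval_upd_notin)
      then have "eval (v(x := True)) h" using val[of "v(x := True)"] vh(4)[of "v(x := True)"] by simp
      then show "eval v h" using pos(3) vh(1) by (simp add: eval_upd_notin)
    qed
  next
    fix y assume y: "y \<in> vars r"
    then obtain v where v: "v x" "eval (v(y := True)) r" "\<not> eval (v(y := False)) g" using wit by blast
    have "y \<noteq> x" using y pos(3) by auto
    then have "\<not> eval (v(y := False)) h" using v vh(4)[of "v(y := False)"] by simp
    with v show "\<exists>v. eval (v(y := True)) r \<and> \<not> eval (v(y := False)) h" by blast
  qed (use pos vh in auto)
  then show ?thesis using that vh(3) by blast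
qed

subsection \<open>Shapes of conjunctions\<close>

definition two_shape :: "form \<Rightarrow> bool" where
  "two_shape f \<longleftrightarrow> (\<exists>a b c d. ac f (And (Or a b) (Or c d)))"

definition three_shape :: "form \<Rightarrow> bool" where
  "three_shape f \<longleftrightarrow>
     (\<exists>x y z w u a. ac f (And (Or (Var x) (Var y)) (And (Or (Var z) (Var w)) (Or (Var u) a))))"

definition var_shape :: "form \<Rightarrow> bool" where
  "var_shape f \<longleftrightarrow> (\<exists>x r. ac f (And (Var x) r))"

lemma first_conjunct: "\<exists>c r. ac (And a b) (And c r) \<and> (\<forall>p q. c \<noteq> And p q)"
proof (induction a arbitrary: b)
  case (And a1 a2)
  then show ?case using ac_trans[OF ac_and_assoc] by meson
qed (use ac_refl in blast)+

lemma positive_not_And: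
  assumes "positive c" "\<forall>p q. c \<noteq> And p q"
  obtains x where "c = Var x" | p q where "c = Or p q" "2 \<le> card (vars c)"
proof (cases c)
  case (Or p q)
  then have "card (vars c) = card (vars p) + card (vars q)"
    using assms by (simp add: card_Un_disjoint)
  moreover have "0 < card (vars p)" "0 < card (vars q)" using Or assms card_vars_pos by auto
  ultimately show ?thesis using that Or by auto
qed (use assms that in auto)

lemma card_vars_And: "positive (And a b) \<Longrightarrow> card (vars (And a b)) = card (vars a) + card (vars b)"
  by (simp add: card_Un_disjoint)

lemma card_vars_Or: "positive (Or a b) \<Longrightarrow> card (vars (Or a b)) = card (vars a) + card (vars b)"
  by (simp add: card_Un_disjoint)

lemma card_vars_one: "positive f \<Longrightarrow> card (vars f) \<le> 1 \<Longrightarrow> \<exists>x. f = Var x"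
  using card_vars_pos[of f] positive_singleton[of f] by (auto simp: card_1_singleton_iff le_Suc_eq)

lemma Or_card_two:
  assumes "positive (Or a b)" "card (vars (Or a b)) = 2"
  shows "\<exists>x y. Or a b = Or (Var x) (Var y)"
proof -
  have "positive a" "positive b" using assms by auto
  then show ?thesis
    using assms(2) card_vars_Or[OF assms(1)] card_vars_pos[of a] card_vars_pos[of b]
      card_vars_one[of a] card_vars_one[of b] by force
qed

lemma Or_card_three:
  assumes "positive (Or a b)" "card (vars (Or a b)) \<le> 3"
  shows "\<exists>x c. ac (Or a b) (Or (Var x) c)"
proof -
  have p: "positive a" "positive b" using assms by auto
  have "card (vars a) \<le> 1 \<or> card (vars b) \<le> 1" using assms(2) card_vars_Or[OF assms(1)] by linarith
  then show ?thesis using card_vars_one p ac_refl ac_or_comm by metis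
qed

lemma Or_card_ge: "positive (Or a b) \<Longrightarrow> 2 \<le> card (vars (Or a b))"
  using card_vars_Or[of a b] card_vars_pos[of a] card_vars_pos[of b] by simp

text \<open>Three sizes of at least 2 with sum at most 7 are 2, 2 and at most 3 in some order, and a
  disjunction on at most three variables has a single variable as a disjunct.\<close>

lemma three_Or_shape:
  assumes pos: "positive (And (Or a a') (And (Or b b') (Or c c')))"
    and card: "card (vars (And (Or a a') (And (Or b b') (Or c c')))) < 8"
  shows "three_shape (And (Or a a') (And (Or b b') (Or c c')))"
proof -
  let ?a = "Or a a'" and ?b = "Or b b'" and ?c = "Or c c'"
  have p: "positive ?a" "positive ?b" "positive ?c" using pos by auto
  have ge: "2 \<le> card (vars ?a)" "2 \<le> card (vars ?b)" "2 \<le> card (vars ?c)"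
    using p Or_card_ge by blast+
  have sum: "card (vars ?a) + (card (vars ?b) + card (vars ?c)) < 8"
  proof -
    have "positive (And ?b ?c)" using pos by simp
    then show ?thesis using card card_vars_And[OF pos] card_vars_And[of ?b ?c] by linarith
  qed
  have key: "three_shape f" if h: "ac f (And A (And B C))" "A = Or a1 a2" "B = Or b1 b2" "C = Or c1 c2"
    "positive A" "positive B" "positive C"
    "card (vars A) = 2" "card (vars B) = 2" "card (vars C) \<le> 3" for f A B C a1 a2 b1 b2 c1 c2
  proof -
    obtain x y where A: "A = Or (Var x) (Var y)" using Or_card_two[of a1 a2] h(2,5,8) by auto
    obtain z w where B: "B = Or (Var z) (Var w)" using Or_card_two[of b1 b2] h(3,6,9) by auto
    obtain u d where C: "ac C (Or (Var u) d)" using Or_card_three[of c1 c2] h(4,7,10) by auto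
    have "ac f (And A (And B (Or (Var u) d)))"
      using ac_trans[OF h(1) ac_and[OF ac_refl ac_and[OF ac_refl C]]] .
    then show ?thesis using A B unfolding three_shape_def by blast
  qed
  consider "card (vars ?a) = 2" "card (vars ?b) = 2" "card (vars ?c) \<le> 3"
    | "card (vars ?a) = 2" "card (vars ?c) = 2" "card (vars ?b) \<le> 3"
    | "card (vars ?b) = 2" "card (vars ?c) = 2" "card (vars ?a) \<le> 3"
    using ge sum by linarith
  then show ?thesis
  proof cases
    case 1
    then show ?thesis using key[OF ac_refl refl refl refl] p by blast
  next
    case 2
    have "ac (And ?a (And ?b ?c)) (And ?a (And ?c ?b))" by (rule ac_and[OF ac_refl ac_and_comm])
    then show ?thesis using key[OF _ refl refl refl] p 2 by blast
  next
    case 3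
    have "ac (And ?a (And ?b ?c)) (And ?b (And ?c ?a))"
      by (rule ac_trans[OF ac_and_comm ac_and_assoc])
    then show ?thesis using key[OF _ refl refl refl] p 3 by blast
  qed
qed

lemma shape_ac:
  assumes "ac f g"
  shows "var_shape g \<Longrightarrow> var_shape f" "two_shape g \<Longrightarrow> two_shape f" "three_shape g \<Longrightarrow> three_shape f"
  using ac_trans[OF assms] unfolding var_shape_def two_shape_def three_shape_def by blast+

lemma And_shapes:
  assumes "positive (And a b)" "card (vars (And a b)) < 8"
  shows "var_shape (And a b) \<or> two_shape (And a b) \<or> three_shape (And a b)"
proof -
  have var1: "var_shape (And (Var x) r)" for x r
    unfolding var_shape_def using ac_refl by blast
  have var2: "var_shape (And c (And (Var x) r))" for c x r
    unfolding var_shape_def using ac_and_lcomm by blast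
  have var3: "var_shape (And c (Var x))" for c x
    unfolding var_shape_def using ac_and_comm by blast
  have var4: "var_shape (And c r)" if "var_shape r" for c r
  proof -
    obtain x s where "ac r (And (Var x) s)" using \<open>var_shape r\<close> unfolding var_shape_def by blast
    then show ?thesis using shape_ac(1)[OF ac_and[OF ac_refl]] var2 by blast
  qed
  obtain c r where cr: "ac (And a b) (And c r)" "\<forall>p q. c \<noteq> And p q" using first_conjunct by blast
  have pcr: "positive (And c r)" "card (vars (And c r)) < 8"
    using assms ac_positive[OF cr(1)] ac_vars[OF cr(1)] by auto
  have "var_shape (And c r) \<or> two_shape (And c r) \<or> three_shape (And c r)"
  proof (rule positive_not_And[OF _ cr(2)])
    show "positive c" using pcr by simp
  next
    fix x assume "c = Var x"
    then show ?thesis using var1 by blast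
  next
    fix p q assume c: "c = Or p q" "2 \<le> card (vars c)"
    show ?thesis
    proof (cases r)
      case (Var x)
      then show ?thesis using var3 by blast
    next
      case (Or p' q')
      then show ?thesis using c unfolding two_shape_def using ac_refl by blast
    next
      case (And r1 r2)
      obtain d s where ds: "ac r (And d s)" "\<forall>p q. d \<noteq> And p q" using first_conjunct And by blast
      have ac1: "ac (And c r) (And c (And d s))" using ac_and[OF ac_refl ds(1)] .
      have pds: "positive (And c (And d s))" "card (vars (And c (And d s))) < 8"
        using pcr ac_positive[OF ac1] ac_vars[OF ac1] by auto
      then have "positive (And d s)" by simp
      show ?thesis
      proof (rule positive_not_And[OF _ ds(2)])
        show "positive d" using pds by simp
      next
        fix x assume "d = Var x"
        then show ?thesis using var2 shape_ac(1)[OF ac1] by blast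
      next
        fix p' q' assume d: "d = Or p' q'" "2 \<le> card (vars d)"
        show ?thesis
        proof (cases s)
          case (Var x)
          then show ?thesis using var3[of d x] var4 shape_ac(1)[OF ac1] by blast
        next
          case (Or p'' q'')
          then show ?thesis using three_Or_shape pds c(1) d(1) shape_ac(3)[OF ac1] by blast
        next
          case (And s1 s2)
          obtain e t where et: "ac s (And e t)" "\<forall>p q. e \<noteq> And p q" using first_conjunct And by blast
          have pet: "positive (And e t)" using \<open>positive (And d s)\<close> ac_positive[OF et(1)] by simp
          have vet: "vars s = vars (And e t)" using ac_vars[OF et(1)] .
          show ?thesis
          proof (rule positive_not_And[OF _ et(2)])
            show "positive e" using pet by simp
          next
            fix x assume "e = Var x"
            then have "var_shape s" using et(1) unfolding var_shape_def by blast
            then show ?thesis using var4 shape_ac(1)[OF ac1] by blast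
          next
            fix p'' q'' assume e: "e = Or p'' q''" "2 \<le> card (vars e)"
            \<comment> \<open>Three conjuncts that are disjunctions use at least six variables, so
              whatever follows them is a single variable.\<close>
            have "card (vars c) + (card (vars d) + (card (vars e) + card (vars t))) < 8"
              using pds(2) card_vars_And[OF pds(1)] card_vars_And[OF \<open>positive (And d s)\<close>]
                card_vars_And[OF pet] vet by simp
            then have "card (vars t) \<le> 1" using c(2) d(2) e(2) by linarith
            then obtain x where "t = Var x" using card_vars_one pet by auto
            then have "var_shape s" using et(1) var3 shape_ac(1) by blast
            then show ?thesis using var4 shape_ac(1)[OF ac1] by blast
          qed
        qed (use pds in auto)
      qed
    qed (use pcr in auto)
  qed
  then show ?thesis using shape_ac[OF cr(1)] by blast
qed

subsection \<open>Core inferences\<close>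

text \<open>The situation in which a switch that frees \<open>c\<close> from the conjunction keeps
  the inference valid.\<close>

definition progress :: "form \<Rightarrow> form \<Rightarrow> bool" where
  "progress f g \<longleftrightarrow> (\<exists>c d r. ac f (And (Or c d) r) \<and> valid_inf c g)"

lemma progress_ac: "progress f' g' \<Longrightarrow> ac f f' \<Longrightarrow> ac g g' \<Longrightarrow> progress f g"
  unfolding progress_def using ac_trans ac_valid valid_inf_trans by metis

abbreviation ev :: "form \<Rightarrow> nat set \<Rightarrow> bool" where
  "ev f X \<equiv> eval (\<lambda>x. x \<in> X) f"

lemma ev_mono: "positive f \<Longrightarrow> ev f X \<Longrightarrow> (\<And>x. x \<in> X \<Longrightarrow> x \<in> vars f \<Longrightarrow> x \<in> Y) \<Longrightarrow> ev f Y"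
  by (rule eval_mono[of f "\<lambda>x. x \<in> X"]) auto

lemma not_valid_true_set:
  assumes "positive c" "positive g" "\<not> valid_inf c g"
  shows "\<exists>X. X \<subseteq> vars c \<and> ev c X \<and> \<not> ev g X"
proof -
  obtain v where v: "eval v c" "\<not> eval v g" using assms(3) unfolding valid_inf_def by blast
  let ?X = "{x \<in> vars c. v x}"
  have "ev c ?X = eval v c" by (rule eval_cong_vars) auto
  moreover have "\<not> ev g ?X" using v(2) eval_mono[OF assms(2), of "\<lambda>x. x \<in> ?X" v] by auto
  ultimately show ?thesis using v(1) by (intro exI[of _ ?X]) auto
qed

lemma not_valid_false_set:
  assumes "positive c" "positive f" "\<not> valid_inf f c"
  shows "\<exists>Y. Y \<subseteq> vars c \<and> \<not> ev c (- Y) \<and> ev f (- Y)"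
proof -
  obtain v where v: "eval v f" "\<not> eval v c" using assms(3) unfolding valid_inf_def by blast
  let ?Y = "{x \<in> vars c. \<not> v x}"
  have "ev c (- ?Y) = eval v c" by (rule eval_cong_vars) auto
  moreover have "ev f (- ?Y)" by (rule eval_mono[OF assms(2) v(1)]) auto
  ultimately show ?thesis using v(2) by (intro exI[of _ ?Y]) auto
qed

text \<open>Each of the four disjuncts can be moved to the front by ac.\<close>

lemma progress_two:
  assumes "\<not> progress (And (Or a b) (Or c d)) g" (is "\<not> progress ?f g")
  shows "\<not> valid_inf a g" "\<not> valid_inf b g" "\<not> valid_inf c g" "\<not> valid_inf d g"
proof -
  have p: "\<not> valid_inf e g" if "ac ?f (And (Or e h) r)" for e h r
    using assms that unfolding progress_def by blast
  show "\<not> valid_inf a g" by (rule p, rule ac_refl)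
  show "\<not> valid_inf b g" by (rule p, rule ac_and[OF ac_or_comm ac_refl])
  show "\<not> valid_inf c g" by (rule p, rule ac_and_comm)
  show "\<not> valid_inf d g" by (rule p, rule ac_trans[OF ac_and_comm ac_and[OF ac_or_comm ac_refl]])
qed

lemma progress_three:
  assumes "\<not> progress (And (Or a b) (And (Or c d) (Or e e'))) g" (is "\<not> progress ?f g")
  shows "\<not> valid_inf a g" "\<not> valid_inf b g" "\<not> valid_inf c g" "\<not> valid_inf d g"
    "\<not> valid_inf e g" "\<not> valid_inf e' g"
proof -
  have p: "\<not> valid_inf e g" if "ac ?f (And (Or e h) r)" for e h r
    using assms that unfolding progress_def by blast
  show "\<not> valid_inf a g" by (rule p, rule ac_refl)
  show "\<not> valid_inf b g" by (rule p, rule ac_and[OF ac_or_comm ac_refl])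
  show "\<not> valid_inf c g" by (rule p, rule ac_and_lcomm)
  show "\<not> valid_inf d g" by (rule p, rule ac_trans[OF ac_and_lcomm ac_and[OF ac_or_comm ac_refl]])
  have e: "ac (And (Or a b) (And (Or c d) (Or e e'))) (And (Or e e') (And (Or a b) (Or c d)))"
    by (rule ac_trans[OF ac_sym[OF ac_and_assoc] ac_and_comm])
  show "\<not> valid_inf e g" by (rule p, rule e)
  show "\<not> valid_inf e' g" by (rule p, rule ac_trans[OF e ac_and[OF ac_or_comm ac_refl]])
qed

abbreviation sel :: "form \<Rightarrow> form \<Rightarrow> form \<Rightarrow> form \<Rightarrow> bool \<Rightarrow> bool \<Rightarrow> form" where
  "sel a b c d i k \<equiv> (if i then if k then a else b else if k then c else d)"

text \<open>The index type \<open>bool option\<close> serves as a three-element type.\<close>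

abbreviation sel3 :: "form \<Rightarrow> form \<Rightarrow> form \<Rightarrow> form \<Rightarrow> form \<Rightarrow> form \<Rightarrow> bool option \<Rightarrow> bool \<Rightarrow> form" where
  "sel3 a b c d e e' j l \<equiv> (case j of Some i \<Rightarrow> sel a b c d i l | None \<Rightarrow> if l then e else e')"

lemma core_two_two:
  assumes f: "f = And (Or a b) (Or c d)" and g: "g = Or (And a' b') (And c' d')"
    and pos: "positive f" "positive g" and vars: "vars f = vars g" and card: "card (vars f) < 8"
    and val: "valid_inf f g"
  shows "progress f g \<or> progress (dual g) (dual f)"
proof (rule ccontr)
  assume n: "\<not> ?thesis"
  let ?A = "sel a b c d" and ?B = "sel a' b' c' d'"
  have nv: "\<not> valid_inf (?A i k) g" for i k
    using n progress_two[of a b c d g] unfolding f by simp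
  have pA: "positive (?A i k)" for i k using pos f by simp
  note ex = not_valid_true_set[OF pA pos(2) nv]
  define P where "P = (\<lambda>i k. SOME X. X \<subseteq> vars (?A i k) \<and> ev (?A i k) X \<and> \<not> ev g X)"
  have P: "\<And>i k. P i k \<subseteq> vars (?A i k) \<and> ev (?A i k) (P i k) \<and> \<not> ev g (P i k)"
    unfolding P_def by (rule someI_ex[OF ex])
  have pB: "positive (?B j l)" for j l using pos g by simp
  have "\<not> valid_inf (dual (?B j l)) (dual f)" for j l
    using n progress_two[of "dual a'" "dual b'" "dual c'" "dual d'" "dual f"] unfolding g by simp
  then have nvB: "\<not> valid_inf f (?B j l)" for j l unfolding valid_inf_dual[OF pos(1) pB] .
  define T where "T = (\<lambda>j l. SOME Y. Y \<subseteq> vars (?B j l) \<and> \<not> ev (?B j l) (- Y) \<and> ev f (- Y))"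
  have T: "\<And>j l. T j l \<subseteq> vars (?B j l) \<and> \<not> ev (?B j l) (- T j l) \<and> ev f (- T j l)"
    unfolding T_def by (rule someI_ex[OF not_valid_false_set[OF pB pos(1) nvB]])
  have evf: "ev f X \<longleftrightarrow> (\<forall>i. \<exists>k. ev (?A i k) X)" for X unfolding f by (auto simp: all_bool_eq ex_bool_eq)
  have evg: "ev g X \<longleftrightarrow> (\<exists>j. \<forall>l. ev (?B j l) X)" for X unfolding g by (auto simp: all_bool_eq ex_bool_eq)
  \<comment> \<open>Block coordinates, with \<open>True\<close> for the first position. The value
    \<open>False\<close> outside \<open>vars f\<close> is harmless, as the locale only compares
    variables of \<open>V\<close>.\<close>
  let ?ai = "\<lambda>x. x \<in> vars a \<union> vars b" and ?ak = "\<lambda>x. x \<in> vars a \<union> vars c"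
  let ?bj = "\<lambda>x. x \<in> vars a' \<union> vars b'" and ?bl = "\<lambda>x. x \<in> vars a' \<union> vars c'"
  have locA: "x \<in> vars f \<and> ?ai x = i \<and> ?ak x = k" if "x \<in> vars (?A i k)" for x i k
    using that pos(1) unfolding f by (cases i; cases k) auto
  have locB: "x \<in> vars f \<and> ?bj x = j \<and> ?bl x = l" if "x \<in> vars (?B j l)" for x j l
    using that pos(2) unfolding vars g by (cases j; cases l) auto
  interpret two_by_two "\<lambda>i k. ev (?A i k)" "\<lambda>j l. ev (?B j l)" ?ai ?ak ?bj ?bl P T "vars f"
  proof
    show "finite (vars f)" "card (vars f) < 8" using card by simp_all
    show "ev (?A i k) Y" if "ev (?A i k) X"
      "\<And>x. x \<in> X \<Longrightarrow> x \<in> vars f \<Longrightarrow> ?ai x = i \<Longrightarrow> ?ak x = k \<Longrightarrow> x \<in> Y" for i k X Y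
      by (rule ev_mono[OF pA that(1)]) (use locA that(2) in blast)
    show "ev (?B j l) Y" if "ev (?B j l) X"
      "\<And>x. x \<in> X \<Longrightarrow> x \<in> vars f \<Longrightarrow> ?bj x = j \<Longrightarrow> ?bl x = l \<Longrightarrow> x \<in> Y" for j l X Y
      by (rule ev_mono[OF pB that(1)]) (use locB that(2) in blast)
    show "\<not> ev (?A i k) {}" for i k by (rule eval_all_false[OF pA]) simp
    show "ev (?B j l) UNIV" for j l by (rule eval_all_true[OF pB]) simp
    show "\<exists>j. \<forall>l. ev (?B j l) X" if "\<And>i. \<exists>k. ev (?A i k) X" for X
      using that val evf evg unfolding valid_inf_def by blast
    show "x \<in> vars f \<and> ?ai x = i \<and> ?ak x = k" if "x \<in> P i k" for x i k using locA P that by blast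
    show "t \<in> vars f \<and> ?bj t = j \<and> ?bl t = l" if "t \<in> T j l" for t j l using locB T that by blast
    show "ev (?A i k) (P i k)" for i k using P by blast
    show "\<exists>l. \<not> ev (?B j l) (P i k)" for j i k using P evg by blast
    show "\<not> ev (?B j l) (- T j l)" for j l using T by blast
    show "\<exists>k. ev (?A i k) (- T j l)" for i j l using T evf by blast
  qed
  show False by (rule contradiction)
qed

lemma core_three_two:
  assumes f: "f = And (Or (Var x) (Var y)) (And (Or (Var z) (Var w)) (Or (Var u) a))"
    and g: "g = Or (And a' b') (And c' d')"
    and pos: "positive f" "positive g" and vars: "vars f = vars g" and card: "card (vars f) < 8"
    and val: "valid_inf f g"
  shows "progress f g \<or> progress (dual g) (dual f)"
proof (rule ccontr)
  assume n: "\<not> ?thesis"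
  let ?B = "sel a' b' c' d'"
  have pa: "positive a" and pB: "positive (?B j l)" for j l using pos f g by simp_all
  have "\<not> valid_inf (dual (?B j l)) (dual f)" for j l
    using n progress_two[of "dual a'" "dual b'" "dual c'" "dual d'" "dual f"] unfolding g by simp
  then have nvB: "\<not> valid_inf f (?B j l)" for j l unfolding valid_inf_dual[OF pos(1) pB] .
  define T where "T = (\<lambda>j l. SOME Y. Y \<subseteq> vars (?B j l) \<and> \<not> ev (?B j l) (- Y) \<and> ev f (- Y))"
  have T: "\<And>j l. T j l \<subseteq> vars (?B j l) \<and> \<not> ev (?B j l) (- T j l) \<and> ev f (- T j l)"
    unfolding T_def by (rule someI_ex[OF not_valid_false_set[OF pB pos(1) nvB]])
  have evg: "ev g X \<longleftrightarrow> (\<exists>j. \<forall>l. ev (?B j l) X)" for X unfolding g by (auto simp: all_bool_eq ex_bool_eq)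
  let ?bj = "\<lambda>x. x \<in> vars a' \<union> vars b'" and ?bl = "\<lambda>x. x \<in> vars a' \<union> vars c'"
  have locB: "x \<in> vars f \<and> ?bj x = j \<and> ?bl x = l" if "x \<in> vars (?B j l)" for x j l
    using that pos(2) unfolding vars g by (cases j; cases l) auto
  interpret three_conjuncts x y z w u "ev a" "vars a" "vars f"
  proof
    show "finite (vars f)" "card (vars f) < 8" using card by simp_all
    show "vars f = {x, y, z, w, u} \<union> vars a" unfolding f by auto
    show "distinct [x, y, z, w, u]" "vars a \<inter> {x, y, z, w, u} = {}" using pos(1) unfolding f by auto
    show "ev a Y" if "ev a X" "X \<inter> vars a \<subseteq> Y" for X Y
      by (rule ev_mono[OF pa that(1)]) (use that(2) in blast)
  qed
  have evf: "ev f (- F) \<longleftrightarrow> \<not> falsifies F" for F unfolding f falsifies_def by auto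
  interpret three_by_two x y z w u "ev a" "vars a" "vars f" "\<lambda>j l. ev (?B j l)" ?bj ?bl T
  proof
    show "ev (?B j l) Y" if "ev (?B j l) X"
      "\<And>x. x \<in> X \<Longrightarrow> x \<in> vars f \<Longrightarrow> ?bj x = j \<Longrightarrow> ?bl x = l \<Longrightarrow> x \<in> Y" for j l X Y
      by (rule ev_mono[OF pB that(1)]) (use locB that(2) in blast)
    show "falsifies F" if "\<And>j. \<exists>l. \<not> ev (?B j l) (- F)" for F
    proof (rule ccontr)
      assume "\<not> falsifies F"
      then have "ev g (- F)" using evf val unfolding valid_inf_def by blast
      then show False using that evg by blast
    qed
    show "t \<in> vars f \<and> ?bj t = j \<and> ?bl t = l" if "t \<in> T j l" for t j l using locB T that by blast
    show "\<not> ev (?B j l) (- T j l)" for j l using T by blast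
    show "\<not> falsifies (T j l)" for j l using T evf by blast
  qed
  \<comment> \<open>The counting is constructive here: it yields progress through the disjunct
    \<open>a\<close>, whereas for two conjuncts it ends in a contradiction.\<close>
  have "valid_inf a g" unfolding valid_inf_def
  proof (intro allI impI)
    fix v assume "eval v a"
    then show "eval v g" using a_implies_some[of "{x. v x}"] evg[of "{x. v x}"] by simp
  qed
  then show False using n progress_three(6)[of "Var x" "Var y" "Var z" "Var w" "Var u" a g] unfolding f by blast
qed

lemma core_three_three:
  assumes f: "f = And (Or (Var x) (Var y)) (And (Or (Var z) (Var w)) (Or (Var u) a))"
    and g: "g = Or (And a' b') (Or (And c' d') (And e' f'))"
    and pos: "positive f" "positive g" and vars: "vars f = vars g" and card: "card (vars f) < 8"
    and val: "valid_inf f g"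
  shows "progress f g \<or> progress (dual g) (dual f)"
proof (rule ccontr)
  assume n: "\<not> ?thesis"
  let ?B = "sel3 a' b' c' d' e' f'"
  have pa: "positive a" and pB: "positive (?B j l)" for j l using pos f g by (simp_all split: option.split)
  have "\<not> valid_inf (dual (?B j l)) (dual f)" for j l
    using n progress_three[of "dual a'" "dual b'" "dual c'" "dual d'" "dual e'" "dual f'" "dual f"] unfolding g
    by (simp split: option.split)
  then have nvB: "\<not> valid_inf f (?B j l)" for j l unfolding valid_inf_dual[OF pos(1) pB] .
  define T where "T = (\<lambda>j l. SOME Y. Y \<subseteq> vars (?B j l) \<and> \<not> ev (?B j l) (- Y) \<and> ev f (- Y))"
  have T: "\<And>j l. T j l \<subseteq> vars (?B j l) \<and> \<not> ev (?B j l) (- T j l) \<and> ev f (- T j l)"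
    unfolding T_def by (rule someI_ex[OF not_valid_false_set[OF pB pos(1) nvB]])
  have ex_opt: "(\<exists>j. Q j) \<longleftrightarrow> Q (Some True) \<or> Q (Some False) \<or> Q None" for Q :: "bool option \<Rightarrow> bool"
    by (metis (full_types) option.exhaust)
  have evg: "ev g X \<longleftrightarrow> (\<exists>j. \<forall>l. ev (?B j l) X)" for X
    unfolding g ex_opt by (simp add: all_bool_eq)
  let ?bj = "\<lambda>x. if x \<in> vars a' \<union> vars b' then Some True else if x \<in> vars c' \<union> vars d' then Some False else None"
    and ?bl = "\<lambda>x. x \<in> vars a' \<union> vars c' \<union> vars e'"
  have locB: "x \<in> vars f \<and> ?bj x = j \<and> ?bl x = l" if "x \<in> vars (?B j l)" for x j l
    using that pos(2) unfolding vars g by (cases j; cases l) (auto split: if_splits)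
  interpret three_conjuncts x y z w u "ev a" "vars a" "vars f"
  proof
    show "finite (vars f)" "card (vars f) < 8" using card by simp_all
    show "vars f = {x, y, z, w, u} \<union> vars a" unfolding f by auto
    show "distinct [x, y, z, w, u]" "vars a \<inter> {x, y, z, w, u} = {}" using pos(1) unfolding f by auto
    show "ev a Y" if "ev a X" "X \<inter> vars a \<subseteq> Y" for X Y
      by (rule ev_mono[OF pa that(1)]) (use that(2) in blast)
  qed
  have evf: "ev f (- F) \<longleftrightarrow> \<not> falsifies F" for F unfolding f falsifies_def by auto
  interpret three_by_three x y z w u "ev a" "vars a" "vars f" "\<lambda>j l. ev (?B j l)" ?bj ?bl T
  proof
    show "\<exists>j' j''. j \<noteq> j' \<and> j \<noteq> j'' \<and> j' \<noteq> j'' \<and> (\<forall>k. k = j \<or> k = j' \<or> k = j'')" for j :: "bool option"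
    proof -
      have all: "k = Some True \<or> k = Some False \<or> k = None" for k :: "bool option"
        by (cases k) auto
      from all[of j] show ?thesis
      proof (elim disjE)
        assume "j = Some True"
        then show ?thesis using all by (intro exI[of _ "Some False"] exI[of _ None]) auto
      next
        assume "j = Some False"
        then show ?thesis using all by (intro exI[of _ "Some True"] exI[of _ None]) auto
      next
        assume "j = None"
        then show ?thesis using all by (intro exI[of _ "Some True"] exI[of _ "Some False"]) auto
      qed
    qed
    show "ev (?B j l) Y" if "ev (?B j l) X"
      "\<And>x. x \<in> X \<Longrightarrow> x \<in> vars f \<Longrightarrow> ?bj x = j \<Longrightarrow> ?bl x = l \<Longrightarrow> x \<in> Y" for j l X Y
      by (rule ev_mono[OF pB that(1)]) (use locB that(2) in blast)
    show "ev (?B j l) UNIV" for j l by (rule eval_all_true[OF pB]) simp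
    show "falsifies F" if "\<And>j. \<exists>l. \<not> ev (?B j l) (- F)" for F
    proof (rule ccontr)
      assume "\<not> falsifies F"
      then have "ev g (- F)" using evf val unfolding valid_inf_def by blast
      then show False using that evg by blast
    qed
    show "t \<in> vars f \<and> ?bj t = j \<and> ?bl t = l" if "t \<in> T j l" for t j l using locB T that by blast
    show "\<not> ev (?B j l) (- T j l)" for j l using T by blast
    show "\<not> falsifies (T j l)" for j l using T evf by blast
  qed
  have "valid_inf a g" unfolding valid_inf_def
  proof (intro allI impI)
    fix v assume "eval v a"
    then show "eval v g" using a_implies_some[of "{x. v x}"] evg[of "{x. v x}"] by simp
  qed
  then show False using n progress_three(6)[of "Var x" "Var y" "Var z" "Var w" "Var u" a g] unfolding f by blast
qed

lemma two_shape_cases: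
  assumes "two_shape f" obtains a b c d where "ac f (And (Or a b) (Or c d))"
  using assms unfolding two_shape_def by blast

lemma three_shape_cases:
  assumes "three_shape f"
  obtains x y z w u a where "ac f (And (Or (Var x) (Var y)) (And (Or (Var z) (Var w)) (Or (Var u) a)))"
  using assms unfolding three_shape_def by blast

lemma progress_ac_both:
  assumes "progress f' g' \<or> progress (dual g') (dual f')" "ac f f'" "ac g g'"
  shows "progress f g \<or> progress (dual g) (dual f)"
  using assms progress_ac ac_dual by blast

lemma core_three_any:
  assumes "three_shape f" "two_shape (dual g) \<or> three_shape (dual g)"
    and inf: "nontrivial_inf f g" and card: "card (vars f) < 8"
  shows "progress f g \<or> progress (dual g) (dual f)"
proof -
  obtain x y z w u a where f: "ac f (And (Or (Var x) (Var y)) (And (Or (Var z) (Var w)) (Or (Var u) a)))"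
    (is "ac f ?f") using assms(1) by (rule three_shape_cases)
  have card': "card (vars ?f) < 8" using card ac_vars[OF f] by simp
  from assms(2) show ?thesis
  proof
    assume "two_shape (dual g)"
    then obtain a' b' c' d' where "ac (dual g) (And (Or a' b') (Or c' d'))" by (rule two_shape_cases)
    from ac_Or_dual[OF this]
    have g: "ac g (Or (And (dual a') (dual b')) (And (dual c') (dual d')))" (is "ac g ?g") by simp
    have "nontrivial_inf ?f ?g" using nontrivial_inf_ac[OF inf f g] .
    then have "progress ?f ?g \<or> progress (dual ?g) (dual ?f)"
      by (intro core_three_two[OF refl refl _ _ _ card']) (simp_all only: nontrivial_inf_def)
    then show ?thesis using f g by (rule progress_ac_both)
  next
    assume "three_shape (dual g)"
    then obtain p q s t r b where
      "ac (dual g) (And (Or (Var p) (Var q)) (And (Or (Var s) (Var t)) (Or (Var r) b)))"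
      by (rule three_shape_cases)
    from ac_Or_dual[OF this]
    have g: "ac g (Or (And (Var p) (Var q)) (Or (And (Var s) (Var t)) (And (Var r) (dual b))))"
      (is "ac g ?g") by simp
    have "nontrivial_inf ?f ?g" using nontrivial_inf_ac[OF inf f g] .
    then have "progress ?f ?g \<or> progress (dual ?g) (dual ?f)"
      by (intro core_three_three[OF refl refl _ _ _ card']) (simp_all only: nontrivial_inf_def)
    then show ?thesis using f g by (rule progress_ac_both)
  qed
qed

text \<open>If only the conclusion has the three-part shape, the inference is dualised; the claim is
  symmetric under this.\<close>

lemma core_progress:
  assumes "two_shape f \<or> three_shape f" "two_shape (dual g) \<or> three_shape (dual g)"
    and inf: "nontrivial_inf f g" and card: "card (vars f) < 8"
  shows "progress f g \<or> progress (dual g) (dual f)"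
proof (cases "three_shape f")
  case True
  then show ?thesis using core_three_any assms by blast
next
  case False
  then have two: "two_shape f" using assms(1) by blast
  have card_g: "card (vars (dual g)) < 8" using inf card by (simp add: nontrivial_inf_def)
  show ?thesis
  proof (cases "three_shape (dual g)")
    case True
    then show ?thesis
      using core_three_any[OF True _ nontrivial_inf_dual[OF inf] card_g] two by auto
  next
    case False
    then have "two_shape (dual g)" using assms(2) by blast
    then obtain a' b' c' d' where "ac (dual g) (And (Or a' b') (Or c' d'))" by (rule two_shape_cases)
    from ac_Or_dual[OF this]
    have g: "ac g (Or (And (dual a') (dual b')) (And (dual c') (dual d')))" (is "ac g ?g") by simp
    obtain a b c d where f: "ac f (And (Or a b) (Or c d))" (is "ac f ?f") using two by (rule two_shape_cases)
    have card': "card (vars ?f) < 8" using card ac_vars[OF f] by simp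
    have "nontrivial_inf ?f ?g" using nontrivial_inf_ac[OF inf f g] .
    then have "progress ?f ?g \<or> progress (dual ?g) (dual ?f)"
      by (intro core_two_two[OF refl refl _ _ _ card']) (simp_all only: nontrivial_inf_def)
    then show ?thesis using f g by (rule progress_ac_both)
  qed
qed

section \<open>The induction on the number of variables\<close>

lemma progress_step:
  assumes "progress f g" "nontrivial_inf f g"
  obtains p q where "der f (Or p q)" "nontrivial_inf (Or p q) g"
proof -
  obtain c d r where f: "ac f (And (Or c d) r)" and c: "valid_inf c g"
    using assms(1) unfolding progress_def by blast
  have "ac (And (Or c d) r) (And r (Or d c))"
    by (rule ac_trans[OF ac_and[OF ac_or_comm ac_refl] ac_and_comm])
  then have "der f (And r (Or d c))" using der_ac[OF ac_trans[OF f]] by blast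
  also have "der \<dots> (Or (And r d) c)" by (rule der_step, rule step_switch)
  finally have d: "der f (Or (And r d) c)" .
  \<comment> \<open>\<open>And r d\<close> implies \<open>f\<close> and hence \<open>g\<close>; for
    \<open>c\<close> this is the progress condition.\<close>
  have "valid_inf (Or (And r d) c) g"
    using c ac_eval[OF f] assms(2) unfolding valid_inf_def nontrivial_inf_def by auto
  then show ?thesis using that d nontrivial_inf_der_left[OF assms(2) d] by blast
qed

lemma nontrivial_inf_der:
  assumes "nontrivial_inf f g" "card (vars f) < 8"
  shows "der f g"
  using assms
proof (induction "card (vars f)" arbitrary: f g rule: less_induct)
  case less
  have IH: "der f' g'" if "nontrivial_inf f' g'" "card (vars f') < card (vars f)" for f' g'
    using less.hyps[of f' g'] less.prems(2) that by simp
  \<comment> \<open>Stated for every premise with as many variables as \<open>f\<close>, because it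
    is also applied to duals and, through \<open>from_Or\<close>, to results of a switch.\<close>
  have to_And: "der h (And p q)" if h: "nontrivial_inf h (And p q)" "card (vars h) = card (vars f)" for h p q
  proof -
    obtain h1 h2 where s: "der h (And h1 h2)" "nontrivial_inf h1 p" "nontrivial_inf h2 q"
      using nontrivial_inf_And_split[OF h(1)] .
    have "positive (And p q)" "vars h = vars (And p q)" "vars h1 = vars p" "vars h2 = vars q"
      using h(1) s(2,3) by (simp_all add: nontrivial_inf_def)
    then have "card (vars h1) < card (vars f)" "card (vars h2) < card (vars f)"
      using h(2) card_vars_And[of p q] card_vars_pos[of p] card_vars_pos[of q] by simp_all
    then have "der (And h1 h2) (And p q)" using der_and IH s(2,3) by blast
    with s(1) show ?thesis by (rule der_trans)
  qed
  have from_Or: "der (Or p q) h" if h: "nontrivial_inf (Or p q) h" "card (vars h) = card (vars f)" for h p q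
  proof -
    have "nontrivial_inf (dual h) (And (dual p) (dual q))" using nontrivial_inf_dual[OF h(1)] by simp
    then have "der (dual h) (And (dual p) (dual q))" by (rule to_And) (use h(2) in simp)
    then show ?thesis using der_dual_iff[of h "Or p q"] by simp
  qed
  have progress: "der h k" if h: "nontrivial_inf h k" "card (vars h) = card (vars f)" "progress h k" for h k
  proof -
    obtain p q where s: "der h (Or p q)" "nontrivial_inf (Or p q) k" using progress_step[OF h(3,1)] .
    have "card (vars k) = card (vars f)" using h by (simp add: nontrivial_inf_def)
    with s show ?thesis using from_Or der_trans by blast
  qed
  have var: "der h k" if h: "nontrivial_inf h k" "card (vars h) = card (vars f)" "var_shape h" for h k
  proof -
    obtain x r where hx: "ac h (And (Var x) r)" using h(3) unfolding var_shape_def by blast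
    have n: "nontrivial_inf (And (Var x) r) k" using nontrivial_inf_ac[OF h(1) hx ac_refl] .
    then obtain m where m: "nontrivial_inf r m" "der (And (Var x) m) k" by (rule nontrivial_inf_And_Var)
    have "positive (And (Var x) r)" using n by (simp add: nontrivial_inf_def)
    then have "card (vars r) < card (vars f)"
      using h(2) ac_vars[OF hx] card_vars_And[of "Var x" r] by simp
    then have "der r m" using IH m(1) by blast
    then have "der (And (Var x) r) (And (Var x) m)" by (intro der_and) simp_all
    then show ?thesis using der_ac[OF hx] m(2) der_trans by blast
  qed
  have pos: "positive f" "positive g" "vars f = vars g" using less.prems(1) by (simp_all add: nontrivial_inf_def)
  have dual: "nontrivial_inf (dual g) (dual f)" "card (vars (dual g)) = card (vars f)"
    using nontrivial_inf_dual[OF less.prems(1)] pos(3) by simp_all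
  show "der f g"
  proof (cases f)
    case (Var x)
    then have "g = Var x" using positive_singleton[of g x] pos by simp
    then show ?thesis using Var by simp
  next
    case (Or p q)
    have "card (vars g) = card (vars f)" using pos(3) by simp
    from from_Or[OF less.prems(1)[unfolded Or] this] show ?thesis unfolding Or .
  next
    case fA: (And p q)
    show ?thesis
    proof (cases g)
      case (Var x)
      then have "f = Var x" using positive_singleton[of f x] pos by simp
      then show ?thesis using fA by simp
    next
      case (And p' q')
      from to_And[OF less.prems(1)[unfolded And] refl] show ?thesis unfolding And .
    next
      case (Or p' q')
      have F: "var_shape f \<or> two_shape f \<or> three_shape f"
        using And_shapes[of p q] pos(1) less.prems(2) unfolding fA by blast
      have G: "var_shape (dual g) \<or> two_shape (dual g) \<or> three_shape (dual g)"
        using And_shapes[of "dual p'" "dual q'"] pos less.prems(2) unfolding Or by simp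
      show ?thesis
      proof (cases "var_shape f \<or> var_shape (dual g)")
        case True
        then show ?thesis using var[OF less.prems(1) refl] var[OF dual] der_dual_iff by blast
      next
        case False
        then have "progress f g \<or> progress (dual g) (dual f)"
          using core_progress F G less.prems by blast
        then show ?thesis using progress[OF less.prems(1) refl] progress[OF dual] der_dual_iff by blast
      qed
    qed (use pos in auto)
  qed (use pos in auto)
qed

theorem theorem2p13:
  fixes \<phi> \<psi> :: form and n :: nat
  assumes "n < 8"
    and "constant_free \<phi>" and "negation_free \<phi>"
    and "constant_free \<psi>" and "negation_free \<psi>"
    and "vars \<phi> = vars \<psi>" and "card (vars \<phi>) = n"
    and "linear_inference \<phi> \<psi>"
    and "\<not> trivial \<phi> \<psi>"
  shows "derivable {switch, medial} \<phi> \<psi>"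
proof -
  have "nontrivial_inf \<phi> \<psi>"
    using assms by (intro nontrivial_infI) (auto simp: positive_iff linear_inference_def)
  then have "der \<phi> \<psi>" using nontrivial_inf_der assms(1,7) by blast
  then show ?thesis using der_derivable assms(8) by (simp add: linear_inference_def)
qed

end
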